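(* Let $K$ be a field with an arbitrary real-valued valuation $\operatorname{val}$, let $R=K[x_1,\dots,x_n]$, and let $I$ be a homogeneous ideal in $R$. Then the $f$-vector of the tropical variety $\mathcal{T}(I)$ with a tropical basis $T$, consisting of $s$ polynomials of degree at most $d$, is bounded by $$f_j \ \leq\ \sum_{i=1}^{n-j}(-1)^{n+i-j}\binom{n-j-1}{i-1}\binom{sdi+n-1}{n-1}.$$
   Context: The tropical variety $\mathcal{T}(I)\subset\mathbb{R}^n$ is the topological closure of $\{(\operatorname{val}(z_1),\dots,\operatorname{val}(z_n)) : z\in V(I)\cap(K\setminus\{0\})^n\}$, where $V(I)$ is the vanishing locus of $I$ (as usual, over an algebraically closed field with nontrivial valuation, after extending $K$ if necessary). It is the support of a polyhedral complex in $\mathbb{R}^n$ whose dimension agrees with the Krull dimension of $I$. For a polynomial $f$, the tropical hypersurface $\mathcal{T}(f)$ is the tropical variety of the ideal generated by $f$. A tropical basis of $I$ is a finite generating subset $T$ of $I$ such that $\mathcal{T}(I)=\bigcap_{f\in T}\mathcal{T}(f)$. Degree means total degree. The $f$-vector of a polyhedral complex counts its cells by dimension: $f_j$ is the number of $j$-dimensional cells. Here $\mathcal{T}(I)$ is regarded as a polyhedral complex via $T$ as follows. Each $h=\sum_u c_ux^u\in T$ subdivides $\mathbb{R}^n$ into the polyhedral complex whose relatively open cells are the sets of $w$ for which the set of exponents $u$ (with $c_u\neq 0$) minimizing $\operatorname{val}(c_u)+w\cdot u$ is a fixed set; this complex is dual to the regular subdivision of the Newton polytope of $h$ obtained by lifting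 each exponent $u$ to $\operatorname{val}(c_u)$. Since $\mathcal{T}(I)=\bigcap_{f\in T}\mathcal{T}(f)$, the tropical variety is a subcomplex of the common refinement of these complexes.
   Formalization: Cells are counted by dimension modulo the direction (1,…,1), not in R^n, and the polynomials in the tropical basis T are assumed homogeneous; the bound fails otherwise (e.g. a smooth tropical conic, n=3, has 9 two-dimensional cells in R^3 against a bound of 6). *)

theory Defs
  imports "HOL-Analysis.Analysis" "HOL-Library.Poly_Mapping"
    "HOL-Computational_Algebra.Polynomial"
begin

text \<open>The ring \<open>K[x\<^sub>1,\<dots>,x\<^sub>n]\<close>: finitely supported maps from exponent vectors to \<open>K\<close>,
  with the convolution product of \<^theory>\<open>HOL-Library.Poly_Mapping\<close>. The variables are
  indexed by a finite type \<open>'n\<close>, so \<open>n = CARD('n)\<close>. The support of \<open>f\<close> is \<open>Poly_Mapping.keys f\<close>.\<close>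

type_synonym ('n, 'k) mpoly = "('n \<Rightarrow>\<^sub>0 nat) \<Rightarrow>\<^sub>0 'k"

definition exp_degree :: "('n::finite \<Rightarrow>\<^sub>0 nat) \<Rightarrow> nat" where
  "exp_degree u = (\<Sum>i\<in>UNIV. Poly_Mapping.lookup u i)"

definition total_degree :: "('n::finite, 'k::zero) mpoly \<Rightarrow> nat" where
  "total_degree f = Max (insert 0 (exp_degree ` Poly_Mapping.keys f))"

definition homogeneous :: "('n::finite, 'k::zero) mpoly \<Rightarrow> bool" where
  "homogeneous f \<longleftrightarrow> (\<exists>e. \<forall>u\<in>Poly_Mapping.keys f. exp_degree u = e)"

text \<open>Ideals are the submodules of the ring regarded as a module over itself.\<close>

lemma module_times: "module ((*) :: 'a::comm_ring_1 \<Rightarrow> 'a \<Rightarrow> 'a)"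
  by unfold_locales (simp_all add: algebra_simps)

definition is_ideal :: "'a::comm_ring_1 set \<Rightarrow> bool" where
  "is_ideal I \<longleftrightarrow> module.subspace (*) I"

definition ideal_generated :: "'a::comm_ring_1 set \<Rightarrow> 'a set" where
  "ideal_generated S = module.span (*) S"

definition homogeneous_ideal :: "('n::finite, 'k::comm_ring_1) mpoly set \<Rightarrow> bool" where
  "homogeneous_ideal I \<longleftrightarrow>
     is_ideal I \<and> (\<exists>S. (\<forall>f\<in>S. homogeneous f) \<and> I = ideal_generated S)"

definition valuation :: "('k::field \<Rightarrow> ereal) \<Rightarrow> bool" where
  "valuation v \<longleftrightarrow>
     (\<forall>x. v x = \<infinity> \<longleftrightarrow> x = 0) \<and> (\<forall>x. v x \<noteq> -\<infinity>) \<and>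
     (\<forall>x y. v (x * y) = v x + v y) \<and> (\<forall>x y. v (x + y) \<ge> min (v x) (v y))"

definition nontrivial_valuation :: "('k::field \<Rightarrow> ereal) \<Rightarrow> bool" where
  "nontrivial_valuation v \<longleftrightarrow> valuation v \<and> (\<exists>x. x \<noteq> 0 \<and> v x \<noteq> 0)"

definition valued_field_extension ::
  "('k::field \<Rightarrow> ereal) \<Rightarrow> ('l::field \<Rightarrow> ereal) \<Rightarrow> ('k \<Rightarrow> 'l) \<Rightarrow> bool" where
  "valued_field_extension v vL \<iota> \<longleftrightarrow>
     \<iota> 1 = 1 \<and> (\<forall>x y. \<iota> (x + y) = \<iota> x + \<iota> y) \<and> (\<forall>x y. \<iota> (x * y) = \<iota> x * \<iota> y) \<and>
     (\<forall>x. vL (\<iota> x) = v x)"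

definition eval_mpoly ::
  "('k::field \<Rightarrow> 'l::field) \<Rightarrow> ('n::finite, 'k) mpoly \<Rightarrow> 'l ^ 'n \<Rightarrow> 'l" where
  "eval_mpoly \<iota> f z =
     (\<Sum>u\<in>Poly_Mapping.keys f. \<iota> (Poly_Mapping.lookup f u) *
        (\<Prod>i\<in>UNIV. (z $ i) ^ Poly_Mapping.lookup u i))"

definition vanishing_locus ::
  "('k::field \<Rightarrow> 'l::field) \<Rightarrow> ('n::finite, 'k) mpoly set \<Rightarrow> ('l ^ 'n) set" where
  "vanishing_locus \<iota> I = {z. \<forall>f\<in>I. eval_mpoly \<iota> f z = 0}"

text \<open>The points \<open>z\<close> have coordinates in the extension field \<open>'l\<close>. For nonzero coordinates
  the valuation is finite, so \<open>real_of_ereal\<close> loses nothing here.\<close>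

definition tropical_variety ::
  "('l::field \<Rightarrow> ereal) \<Rightarrow> ('k::field \<Rightarrow> 'l) \<Rightarrow> ('n::finite, 'k) mpoly set \<Rightarrow> (real ^ 'n) set" where
  "tropical_variety vL \<iota> I =
     closure {(\<chi> i. real_of_ereal (vL (z $ i))) | z. z \<in> vanishing_locus \<iota> I \<and> (\<forall>i. z $ i \<noteq> 0)}"

definition tropical_hypersurface ::
  "('l::field \<Rightarrow> ereal) \<Rightarrow> ('k::field \<Rightarrow> 'l) \<Rightarrow> ('n::finite, 'k) mpoly \<Rightarrow> (real ^ 'n) set" where
  "tropical_hypersurface vL \<iota> f = tropical_variety vL \<iota> (ideal_generated {f})"

definition tropical_basis ::
  "('l::field \<Rightarrow> ereal) \<Rightarrow> ('k::field \<Rightarrow> 'l) \<Rightarrow>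
     ('n::finite, 'k) mpoly set \<Rightarrow> ('n, 'k) mpoly set \<Rightarrow> bool" where
  "tropical_basis vL \<iota> I T \<longleftrightarrow>
     finite T \<and> ideal_generated T = I \<and>
     tropical_variety vL \<iota> I = (\<Inter>f\<in>T. tropical_hypersurface vL \<iota> f)"

definition minimizing_exponents ::
  "('k::field \<Rightarrow> ereal) \<Rightarrow> ('n::finite, 'k) mpoly \<Rightarrow> real ^ 'n \<Rightarrow> ('n \<Rightarrow>\<^sub>0 nat) set" where
  "minimizing_exponents v h w =
     (let val = (\<lambda>u. v (Poly_Mapping.lookup h u) +
        ereal (\<Sum>i\<in>UNIV. w $ i * real (Poly_Mapping.lookup u i)))
      in {u \<in> Poly_Mapping.keys h. \<forall>u'\<in>Poly_Mapping.keys h. val u \<le> val u'})"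

definition hypersurface_complex ::
  "('k::field \<Rightarrow> ereal) \<Rightarrow> ('n::finite, 'k) mpoly \<Rightarrow> (real ^ 'n) set set" where
  "hypersurface_complex v h =
     {closure {w'. minimizing_exponents v h w' = minimizing_exponents v h w} | w. True}"

text \<open>Polyhedral complexes are sets of nonempty closed cells. The cells of the common refinement
  are the nonempty intersections of one cell from each complex.\<close>

definition common_refinement ::
  "('k::field \<Rightarrow> ereal) \<Rightarrow> ('n::finite, 'k) mpoly set \<Rightarrow> (real ^ 'n) set set" where
  "common_refinement v T =
     {\<Inter>h\<in>T. C h | C. \<forall>h\<in>T. C h \<in> hypersurface_complex v h} - {{}}"

definition tropical_complex ::
  "('k::field \<Rightarrow> ereal) \<Rightarrow> ('l::field \<Rightarrow> ereal) \<Rightarrow> ('k \<Rightarrow> 'l) \<Rightarrow>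
     ('n::finite, 'k) mpoly set \<Rightarrow> ('n, 'k) mpoly set \<Rightarrow> (real ^ 'n) set set" where
  "tropical_complex v vL \<iota> I T = {C \<in> common_refinement v T. C \<subseteq> tropical_variety vL \<iota> I}"

text \<open>For homogeneous polynomials every cell is invariant under translation along
  \<open>(1,\<dots>,1)\<close>, and cells are counted in the tropical projective torus
  \<open>\<real>\<^sup>n / \<real>(1,\<dots>,1)\<close>. The quotient is realised as the hyperplane of vectors with coordinate
  sum zero, the quotient map being the orthogonal projection along \<open>(1,\<dots>,1)\<close>.\<close>

definition torus_projection :: "real ^ 'n::finite \<Rightarrow> real ^ 'n" where
  "torus_projection w = (\<chi> i. w $ i - (\<Sum>k\<in>UNIV. w $ k) / real CARD('n))"

definition projective_complex :: "(real ^ 'n::finite) set set \<Rightarrow> (real ^ 'n) set set" where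
  "projective_complex \<C> = (\<lambda>C. torus_projection ` C) ` \<C>"

definition f_vector :: "(real ^ 'n::finite) set set \<Rightarrow> nat \<Rightarrow> nat" where
  "f_vector \<C> j = card {C \<in> \<C>. aff_dim C = int j}"

text \<open>The complexes that occur are finite, so \<^const>\<open>card\<close> really counts their cells.\<close>

lemma finite_hypersurface_complex: "finite (hypersurface_complex v h)"
proof -
  have "hypersurface_complex v h \<subseteq>
      (\<lambda>A. closure {w'. minimizing_exponents v h w' = A}) ` Pow (Poly_Mapping.keys h)"
    by (auto simp: hypersurface_complex_def minimizing_exponents_def Let_def)
  then show ?thesis
    by (rule finite_subset) simp
qed

lemma finite_projective_tropical_complex:
  assumes "finite T"
  shows "finite (projective_complex (tropical_complex v vL \<iota> I T))"
proof -
  have "common_refinement v T \<subseteq>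
      (\<lambda>C. \<Inter>h\<in>T. C h) ` (Pi\<^sub>E T (hypersurface_complex v))"
  proof
    fix D assume "D \<in> common_refinement v T"
    then obtain C where C: "D = (\<Inter>h\<in>T. C h)" "\<forall>h\<in>T. C h \<in> hypersurface_complex v h"
      by (auto simp: common_refinement_def)
    then have "restrict C T \<in> Pi\<^sub>E T (hypersurface_complex v)" "D = (\<Inter>h\<in>T. restrict C T h)"
      by auto
    then show "D \<in> (\<lambda>C. \<Inter>h\<in>T. C h) ` (Pi\<^sub>E T (hypersurface_complex v))"
      by blast
  qed
  then have "finite (common_refinement v T)"
    using assms finite_hypersurface_complex
    by (meson finite_PiE finite_imageI finite_subset)
  then show ?thesis
    by (simp add: projective_complex_def tropical_complex_def)
qed

end

theory Submission
  imports Defs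
begin

text \<open>The bound is the face count of a unimodular triangulation. Put \<open>N = s d\<close> and
  \<open>k = n - j - 1\<close>, and let \<open>L m\<close> be the number of lattice points of the \<open>m\<close>-th dilate of the
  simplex of nonnegative vectors with coordinate sum \<open>N\<close>, so \<open>L m = (N m + n - 1) choose (n - 1)\<close>.
  The alternating sum is the \<open>k\<close>-th forward difference of \<open>L\<close> at \<open>1\<close>; a unimodular
  triangulation of the simplex would have exactly that many \<open>k\<close>-dimensional faces. The proof
  bounds the number of all cells of the common refinement, of which the tropical complex is a part.

  Duality. A cell of the common refinement is determined by the sets of exponents at which the
  polynomials attain their minima at an inner point \<open>w\<close> of the cell. These sets form one lower face
  of the configuration of all sums \<open>\<Sum>h. u\<^sub>h\<close> of exponents, one from each polynomial, lifted to the
  sum of the valuations of their coefficients. Since the polynomials are homogeneous of degree at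
  most \<open>d\<close>, these sums can be translated into the dilated simplex of size \<open>N\<close>. A cell of dimension
  \<open>j\<close> in the torus comes from a face of dimension \<open>k\<close> (\<open>aff_dim_projected_cell\<close>,
  \<open>lower_face_PiE\<close>, \<open>aff_dim_sum_PiE\<close>).

  Refinement to a triangulation. Each lattice point \<open>z\<close> in the cone over the configuration, with
  the vertices of the simplex added, has a unique representation as a nonnegative combination that
  is minimal for a total order. The order compares the weight on the added vertices, then the
  lifted heights, and then breaks ties. The supports of minimal representations are the simplices
  of a triangulation. Each \<open>k\<close>-dimensional lower face contains
  a simplex with \<open>k + 1\<close> vertices that spans it (\<open>full_simplex_in_face\<close>), and a lower face can be
  recovered from such a simplex. So it suffices to bound the number of simplices.

  Counting. Split the coefficients of the minimal representation of a lattice point into parts in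
  \<open>{0<..1}\<close> and natural numbers. The fractional parts form one of finitely many box points.
  A box point of height \<open>h\<close> supported on \<open>c\<close> vertices accounts for
  \<open>(m + c - h) choose (c - 1)\<close> of the lattice points at height \<open>m + 1\<close>, so \<open>L (m + 1)\<close> is a sum of
  such binomials. All of their forward differences are nonnegative, and the \<open>k\<close>-th difference at
  \<open>m = 0\<close> is \<open>1\<close> for the sum of the vertices of a simplex with \<open>k + 1\<close> vertices
  (\<open>card_simplices_le\<close>). This is the argument of Betke and McMullen for lattice
  triangulations.\<close>

section \<open>Forward differences and compositions\<close>

definition fdiff :: "(nat \<Rightarrow> int) \<Rightarrow> nat \<Rightarrow> int" where
  "fdiff f m = f (Suc m) - f m"

lemma funpow_fdiff_alternating:
  "(fdiff ^^ k) f m = (\<Sum>i\<le>k. (-1) ^ (k + i) * int (k choose i) * f (m + i))"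
proof (induction k arbitrary: m)
  case 0
  then show ?case by simp
next
  case (Suc k)
  let ?s = "\<lambda>i. (-1 :: int) ^ (k + i)"
  have "(fdiff ^^ Suc k) f m = (fdiff ^^ k) f (Suc m) - (fdiff ^^ k) f m"
    by (simp add: fdiff_def)
  also have "\<dots> = (\<Sum>i\<le>k. ?s i * int (k choose i) * f (Suc m + i))
      + (\<Sum>i\<le>k. - ?s i * int (k choose i) * f (m + i))"
    by (simp add: Suc sum_negf)
  also have "(\<Sum>i\<le>k. ?s i * int (k choose i) * f (Suc m + i))
      = (\<Sum>i\<le>Suc k. (if i = 0 then 0 else - ?s i * int (k choose (i - 1)) * f (m + i)))"
    by (subst sum.atMost_Suc_shift) simp
  also have "(\<Sum>i\<le>k. - ?s i * int (k choose i) * f (m + i))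
      = (\<Sum>i\<le>Suc k. - ?s i * int (k choose i) * f (m + i))"
    by (simp add: binomial_eq_0)
  also have "(\<Sum>i\<le>Suc k. (if i = 0 then 0 else - ?s i * int (k choose (i - 1)) * f (m + i)))
      + (\<Sum>i\<le>Suc k. - ?s i * int (k choose i) * f (m + i))
      = (\<Sum>i\<le>Suc k. - ?s i * int (Suc k choose i) * f (m + i))"
    unfolding sum.distrib [symmetric]
  proof (rule sum.cong [OF refl])
    fix i
    show "(if i = 0 then 0 else - ?s i * int (k choose (i - 1)) * f (m + i))
        + - ?s i * int (k choose i) * f (m + i) = - ?s i * int (Suc k choose i) * f (m + i)"
      by (cases i) (simp_all add: algebra_simps)
  qed
  finally show ?case
    by simp
qed

lemma funpow_fdiff_sum: "(fdiff ^^ k) (\<lambda>m. \<Sum>b\<in>B. g b m) m = (\<Sum>b\<in>B. (fdiff ^^ k) (g b) m)"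
proof (induction k arbitrary: m)
  case (Suc k)
  then show ?case
    by (simp add: fdiff_def sum_subtractf)
qed simp

lemma funpow_fdiff_binomial:
  "(fdiff ^^ k) (\<lambda>m. int ((m + r) choose p)) m = (if k \<le> p then int ((m + r) choose (p - k)) else 0)"
proof (induction k arbitrary: m)
  case (Suc k)
  show ?case
  proof (cases "k < p")
    case True
    then have "p - k = Suc (p - Suc k)"
      by simp
    then show ?thesis
      using True Suc by (simp add: fdiff_def)
  qed (use Suc in \<open>auto simp: fdiff_def\<close>)
qed simp

text \<open>Listing \<open>A\<close> turns these functions into lists of length \<open>card A\<close> with sum \<open>t\<close>, which are
  counted by stars and bars.\<close>

lemma card_nat_weights:
  assumes "finite A"
  shows "card {f :: 'a \<Rightarrow> nat. (\<forall>x. x \<notin> A \<longrightarrow> f x = 0) \<and> sum f A = t} = (t + card A - 1) choose t"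
proof -
  obtain xs where xs: "set xs = A" "distinct xs"
    using assms finite_distinct_list by blast
  then have len: "length xs = card A"
    using distinct_card by force
  have "bij_betw (\<lambda>f. map f xs) {f :: 'a \<Rightarrow> nat. (\<forall>x. x \<notin> A \<longrightarrow> f x = 0) \<and> sum f A = t}
      {l. length l = card A \<and> sum_list l = t}"
    unfolding bij_betw_def
  proof
    show "inj_on (\<lambda>f. map f xs) {f :: 'a \<Rightarrow> nat. (\<forall>x. x \<notin> A \<longrightarrow> f x = 0) \<and> sum f A = t}"
    proof (rule inj_onI, rule ext)
      fix f g :: "'a \<Rightarrow> nat" and x
      assume "f \<in> {f. (\<forall>x. x \<notin> A \<longrightarrow> f x = 0) \<and> sum f A = t}"
        "g \<in> {f. (\<forall>x. x \<notin> A \<longrightarrow> f x = 0) \<and> sum f A = t}" "map f xs = map g xs"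
      then show "f x = g x"
        using xs by (cases "x \<in> A") auto
    qed
    show "(\<lambda>f. map f xs) ` {f :: 'a \<Rightarrow> nat. (\<forall>x. x \<notin> A \<longrightarrow> f x = 0) \<and> sum f A = t}
        = {l. length l = card A \<and> sum_list l = t}" (is "?F ` ?S = ?R")
    proof
      show "?F ` ?S \<subseteq> ?R"
        using xs len by (auto simp: sum_list_distinct_conv_sum_set)
      show "?R \<subseteq> ?F ` ?S"
      proof
        fix l assume l: "l \<in> ?R"
        define f where "f x = (case map_of (zip xs l) x of None \<Rightarrow> 0 | Some y \<Rightarrow> y)" for x
        have "map f xs = l"
          using l len xs by (auto simp: f_def map_of_zip_nth intro!: nth_equalityI)
        moreover have "f x = 0" if "x \<notin> A" for x
        proof -
          have "map_of (zip xs l) x = None"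
            using that l len xs by (simp add: map_of_zip_is_None)
          then show ?thesis by (simp add: f_def)
        qed
        moreover have "sum f A = t"
          using xs l \<open>map f xs = l\<close> sum_list_distinct_conv_sum_set [of xs f] by simp
        ultimately show "l \<in> ?F ` ?S"
          by (intro image_eqI [of _ _ f]) simp_all
      qed
    qed
  qed
  from bij_betw_same_card [OF this] show ?thesis
    by (simp only: card_length_sum_list)
qed

section \<open>Total orders on weight functions\<close>

definition lincomb :: "'x set \<Rightarrow> ('x \<Rightarrow> 'v::real_vector) \<Rightarrow> ('x \<Rightarrow> real) \<Rightarrow> 'v" where
  "lincomb X a \<alpha> = (\<Sum>x\<in>X. \<alpha> x *\<^sub>R a x)"

text \<open>The set of positive elements of a total order on the functions supported in \<open>X\<close> that is
  compatible with addition and with scaling by positive reals. Working with an abstract order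
  replaces a generic perturbation of the lifting function.\<close>

definition total_cone :: "'x set \<Rightarrow> (('x \<Rightarrow> real) \<Rightarrow> bool) \<Rightarrow> bool" where
  "total_cone X P \<longleftrightarrow>
     (\<forall>\<delta> \<epsilon>. P \<delta> \<longrightarrow> P \<epsilon> \<longrightarrow> P (\<lambda>x. \<delta> x + \<epsilon> x)) \<and>
     (\<forall>\<delta> c. 0 < c \<longrightarrow> P \<delta> \<longrightarrow> P (\<lambda>x. c * \<delta> x)) \<and>
     \<not> P (\<lambda>x. 0) \<and>
     (\<forall>\<delta>. (\<exists>x\<in>X. \<delta> x \<noteq> 0) \<longrightarrow> (\<forall>x. x \<notin> X \<longrightarrow> \<delta> x = 0) \<longrightarrow> P \<delta> \<or> P (\<lambda>x. - \<delta> x))"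

text \<open>The lexicographic order, built one coordinate at a time.\<close>

lemma total_cone_exists:
  assumes "finite X"
  shows "\<exists>P. total_cone X P"
  using assms
proof (induction X rule: finite_induct)
  case empty
  have "total_cone {} (\<lambda>_. False)"
    by (simp add: total_cone_def)
  then show ?case by blast
next
  case (insert b X)
  then obtain P where P: "total_cone X P"
    by blast
  have "total_cone (insert b X) (\<lambda>\<delta>. 0 < \<delta> b \<or> \<delta> b = 0 \<and> P \<delta>)"
    unfolding total_cone_def
  proof (intro conjI allI impI)
    fix \<delta> :: "'a \<Rightarrow> real"
    assume *: "\<exists>x\<in>insert b X. \<delta> x \<noteq> 0" "\<forall>x. x \<notin> insert b X \<longrightarrow> \<delta> x = 0"
    show "(0 < \<delta> b \<or> \<delta> b = 0 \<and> P \<delta>) \<or> 0 < - \<delta> b \<or> - \<delta> b = 0 \<and> P (\<lambda>x. - \<delta> x)"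
    proof (cases "\<delta> b = 0")
      case True
      then have "P \<delta> \<or> P (\<lambda>x. - \<delta> x)"
        using P * unfolding total_cone_def by (metis insert_iff)
      then show ?thesis using True by auto
    qed linarith
  qed (use P in \<open>auto simp: total_cone_def\<close>)
  then show ?case by blast
qed

text \<open>A linear functional with coefficients \<open>g\<close> may be compared first, the given order then
  serving to break ties. This is how a lifting function enters the order.\<close>

lemma total_cone_refine:
  assumes P: "total_cone X P"
  shows "total_cone X (\<lambda>\<delta>. 0 < (\<Sum>x\<in>X. g x * \<delta> x) \<or> (\<Sum>x\<in>X. g x * \<delta> x) = 0 \<and> P \<delta>)"
proof -
  have add: "(\<Sum>x\<in>X. g x * (\<delta> x + \<epsilon> x)) = (\<Sum>x\<in>X. g x * \<delta> x) + (\<Sum>x\<in>X. g x * \<epsilon> x)" for \<delta> \<epsilon>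
    by (simp add: algebra_simps sum.distrib)
  have scale: "(\<Sum>x\<in>X. g x * (c * \<delta> x)) = c * (\<Sum>x\<in>X. g x * \<delta> x)" for c \<delta>
    by (simp add: sum_distrib_left algebra_simps)
  have neg: "(\<Sum>x\<in>X. g x * - \<delta> x) = - (\<Sum>x\<in>X. g x * \<delta> x)" for \<delta>
    by (simp add: sum_negf)
  show ?thesis
    unfolding total_cone_def add scale neg
  proof (intro conjI allI impI)
    fix \<delta> :: "'a \<Rightarrow> real"
    assume "\<exists>x\<in>X. \<delta> x \<noteq> 0" "\<forall>x. x \<notin> X \<longrightarrow> \<delta> x = 0"
    then have "P \<delta> \<or> P (\<lambda>x. - \<delta> x)"
      using P unfolding total_cone_def by blast
    then show "(0 < (\<Sum>x\<in>X. g x * \<delta> x) \<or> (\<Sum>x\<in>X. g x * \<delta> x) = 0 \<and> P \<delta>) \<or>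
        0 < - (\<Sum>x\<in>X. g x * \<delta> x) \<or> - (\<Sum>x\<in>X. g x * \<delta> x) = 0 \<and> P (\<lambda>x. - \<delta> x)"
      by linarith
  qed (use P in \<open>auto simp: total_cone_def\<close>)
qed

section \<open>The triangulation defined by minimal representations\<close>

text \<open>Points \<open>a x\<close> at height \<open>1\<close>, indexed by \<open>X\<close> with repetitions allowed. The height condition
  bounds the weights of a given combination, so that minimal ones exist.\<close>

locale weighted_configuration =
  fixes X :: "'x set" and a :: "'x \<Rightarrow> 'v::real_vector" and height :: "'v \<Rightarrow> real"
    and P :: "('x \<Rightarrow> real) \<Rightarrow> bool"
  assumes finite_X: "finite X"
    and linear_height: "linear height"
    and height_a: "x \<in> X \<Longrightarrow> height (a x) = 1"
    and cone: "total_cone X P"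
begin

definition weights :: "('x \<Rightarrow> real) set" where
  "weights = {\<alpha>. (\<forall>x. 0 \<le> \<alpha> x) \<and> (\<forall>x. x \<notin> X \<longrightarrow> \<alpha> x = 0)}"

definition supp :: "('x \<Rightarrow> real) \<Rightarrow> 'x set" where
  "supp \<alpha> = {x \<in> X. \<alpha> x \<noteq> 0}"

text \<open>Strict minimality among all representations of the same vector, which makes optimal
  representations unique.\<close>

definition optimal :: "('x \<Rightarrow> real) \<Rightarrow> bool" where
  "optimal \<alpha> \<longleftrightarrow> \<alpha> \<in> weights \<and>
     (\<forall>\<nu>\<in>weights. lincomb X a \<nu> = lincomb X a \<alpha> \<longrightarrow> \<nu> \<noteq> \<alpha> \<longrightarrow> P (\<lambda>x. \<nu> x - \<alpha> x))"

text \<open>Linear independence of the indexed family, which also excludes repeated points.\<close>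

definition free_family :: "'x set \<Rightarrow> bool" where
  "free_family \<sigma> \<longleftrightarrow>
     (\<forall>\<delta>. (\<forall>x. x \<notin> \<sigma> \<longrightarrow> \<delta> x = 0) \<longrightarrow> lincomb X a \<delta> = 0 \<longrightarrow> (\<forall>x. \<delta> x = 0))"

text \<open>By \<open>optimal_of_supp\<close> optimality depends on the support alone, so the indicator function
  stands for all positive weights on \<open>\<sigma>\<close>.\<close>

definition simplices :: "'x set set" where
  "simplices = {\<sigma>. \<sigma> \<subseteq> X \<and> \<sigma> \<noteq> {} \<and> optimal (indicat_real \<sigma>)}"

lemma free_familyD:
  assumes "free_family \<sigma>" and "\<And>x. x \<notin> \<sigma> \<Longrightarrow> \<delta> x = 0" and "lincomb X a \<delta> = 0"
  shows "\<delta> x = 0"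
  using assms unfolding free_family_def by metis

lemma P_add: "P \<delta> \<Longrightarrow> P \<epsilon> \<Longrightarrow> P (\<lambda>x. \<delta> x + \<epsilon> x)"
  and P_scale: "0 < c \<Longrightarrow> P \<delta> \<Longrightarrow> P (\<lambda>x. c * \<delta> x)"
  and P_zero: "\<not> P (\<lambda>x. 0)"
  and P_total: "\<delta> x \<noteq> 0 \<Longrightarrow> (\<And>x. x \<notin> X \<Longrightarrow> \<delta> x = 0) \<Longrightarrow> P \<delta> \<or> P (\<lambda>x. - \<delta> x)"
  using cone unfolding total_cone_def by blast+

lemma P_asym: "P \<delta> \<Longrightarrow> \<not> P (\<lambda>x. - \<delta> x)"
  using P_add [of \<delta> "\<lambda>x. - \<delta> x"] P_zero by auto

lemma P_scale_cancel: "0 < c \<Longrightarrow> P (\<lambda>x. c * \<delta> x) \<Longrightarrow> P \<delta>"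
  using P_scale [of "inverse c" "\<lambda>x. c * \<delta> x"] by (simp add: mult.assoc [symmetric])

lemma lincomb_add: "lincomb X a (\<lambda>x. \<delta> x + \<epsilon> x) = lincomb X a \<delta> + lincomb X a \<epsilon>"
  and lincomb_diff: "lincomb X a (\<lambda>x. \<delta> x - \<epsilon> x) = lincomb X a \<delta> - lincomb X a \<epsilon>"
  and lincomb_scale: "lincomb X a (\<lambda>x. c * \<delta> x) = c *\<^sub>R lincomb X a \<delta>"
  by (simp_all add: lincomb_def sum.distrib sum_subtractf scaleR_left_distrib scaleR_left_diff_distrib
      scaleR_sum_right)

lemma height_lincomb: "height (lincomb X a \<delta>) = sum \<delta> X"
proof -
  have "height (lincomb X a \<delta>) = (\<Sum>x\<in>X. \<delta> x * height (a x))"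
    using linear_height by (simp add: lincomb_def linear_sum linear_scale)
  also have "\<dots> = sum \<delta> X"
    by (rule sum.cong) (simp_all add: height_a)
  finally show ?thesis .
qed

lemma supp_finite: "finite (supp \<alpha>)"
  using finite_X by (simp add: supp_def)

lemma weights_pos: "\<alpha> \<in> weights \<Longrightarrow> x \<in> supp \<alpha> \<Longrightarrow> 0 < \<alpha> x"
  by (force simp: weights_def supp_def order.strict_iff_order)

lemma weights_notin_supp: "\<alpha> \<in> weights \<Longrightarrow> x \<notin> supp \<alpha> \<Longrightarrow> \<alpha> x = 0"
  by (auto simp: weights_def supp_def)

lemma weights_perturb:
  assumes "\<alpha> \<in> weights" and "\<And>x. x \<notin> X \<Longrightarrow> \<delta> x = 0"
    and "\<And>x. \<delta> x < 0 \<Longrightarrow> x \<in> supp \<alpha>"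
  shows "\<exists>c>0. (\<lambda>x. \<alpha> x + c * \<delta> x) \<in> weights"
proof -
  have "\<forall>\<^sub>F c in at_right 0. 0 \<le> \<alpha> x + c * \<delta> x" if "x \<in> X" for x
  proof (cases "\<delta> x < 0")
    case True
    then have "0 < \<alpha> x"
      using assms weights_pos by blast
    have "((\<lambda>c. \<alpha> x + c * \<delta> x) \<longlongrightarrow> \<alpha> x + 0 * \<delta> x) (at_right 0)"
      by (intro tendsto_intros)
    then have "\<forall>\<^sub>F c in at_right 0. 0 < \<alpha> x + c * \<delta> x"
      using \<open>0 < \<alpha> x\<close> by (auto intro: order_tendstoD)
    then show ?thesis
      by (rule eventually_mono) simp
  next
    case False
    have "\<forall>\<^sub>F c :: real in at_right 0. 0 < c"
      by (simp add: eventually_at_right_less)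
    then show ?thesis
      by (rule eventually_mono) (use False assms(1) in \<open>auto simp: weights_def\<close>)
  qed
  then have "\<forall>\<^sub>F c in at_right 0. \<forall>x\<in>X. 0 \<le> \<alpha> x + c * \<delta> x"
    using finite_X by (simp add: eventually_ball_finite)
  moreover have "\<forall>\<^sub>F c :: real in at_right 0. 0 < c"
    by (simp add: eventually_at_right_less)
  ultimately have "\<forall>\<^sub>F c in at_right 0. 0 < c \<and> (\<forall>x\<in>X. 0 \<le> \<alpha> x + c * \<delta> x)"
    by (simp add: eventually_conj_iff)
  then obtain c where c: "0 < c" "\<forall>x\<in>X. 0 \<le> \<alpha> x + c * \<delta> x"
    using eventually_happens' [OF trivial_limit_at_right_real] by blast
  moreover have "\<alpha> x + c * \<delta> x = 0" if "x \<notin> X" for x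
    using that assms(1,2) by (simp add: weights_def)
  ultimately have "(\<lambda>x. \<alpha> x + c * \<delta> x) \<in> weights"
    by (force simp: weights_def)
  then show ?thesis
    using c(1) by blast
qed

lemma optimal_in_weights: "optimal \<alpha> \<Longrightarrow> \<alpha> \<in> weights"
  by (simp add: optimal_def)

text \<open>A direction that can be followed from an optimal \<open>\<alpha>\<close> for a short while, without leaving the
  weights or changing the combination, leads to a competitor of \<open>\<alpha>\<close>; by scaling, the direction
  itself is positive.\<close>

lemma optimal_direction:
  assumes "optimal \<alpha>" and "lincomb X a \<delta> = 0" and "\<delta> y \<noteq> 0"
    and "\<And>x. x \<notin> X \<Longrightarrow> \<delta> x = 0" and "\<And>x. \<delta> x < 0 \<Longrightarrow> x \<in> supp \<alpha>"
  shows "P \<delta>"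
proof -
  obtain c where c: "0 < c" "(\<lambda>x. \<alpha> x + c * \<delta> x) \<in> weights"
    using weights_perturb [of \<alpha> \<delta>] optimal_in_weights [OF assms(1)] assms(4,5) by blast
  have "lincomb X a (\<lambda>x. \<alpha> x + c * \<delta> x) = lincomb X a \<alpha>"
    by (simp add: lincomb_add lincomb_scale assms(2))
  moreover have "(\<lambda>x. \<alpha> x + c * \<delta> x) \<noteq> \<alpha>"
    using c(1) assms(3) by (metis add_cancel_left_right less_irrefl mult_eq_0_iff)
  ultimately have "P (\<lambda>x. (\<alpha> x + c * \<delta> x) - \<alpha> x)"
    using assms(1) c(2) unfolding optimal_def by blast
  then show ?thesis
    using c(1) P_scale_cancel by simp
qed

text \<open>A linear relation on the support could be followed in both directions, and both would
  have to be positive.\<close>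

lemma free_family_optimal:
  assumes "optimal \<alpha>"
  shows "free_family (supp \<alpha>)"
  unfolding free_family_def
proof (intro allI impI, rule ccontr)
  fix \<delta> :: "'x \<Rightarrow> real" and y
  assume \<delta>: "\<forall>x. x \<notin> supp \<alpha> \<longrightarrow> \<delta> x = 0" "lincomb X a \<delta> = 0" "\<delta> y \<noteq> 0"
  have out: "\<delta> x = 0" if "x \<notin> X" for x
    using \<delta>(1) that by (simp add: supp_def)
  have "P \<delta>"
  proof (rule optimal_direction [OF assms \<delta>(2,3) out])
    show "x \<in> supp \<alpha>" if "\<delta> x < 0" for x
      using \<delta>(1) that by (metis less_irrefl)
  qed
  moreover have "P (\<lambda>x. - \<delta> x)"
  proof (rule optimal_direction [OF assms, where y = y])
    show "lincomb X a (\<lambda>x. - \<delta> x) = 0"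
      using \<delta>(2) lincomb_scale [of "-1" \<delta>] by simp
    show "x \<in> supp \<alpha>" if "- \<delta> x < 0" for x
      using \<delta>(1) that by (metis less_irrefl neg_0_equal_iff_equal)
  qed (simp_all add: \<delta>(3) out)
  ultimately show False
    using P_asym by blast
qed

text \<open>A competitor of \<open>\<mu>\<close> gives a direction that can only be negative on the support of \<open>\<mu>\<close>,
  hence one that can be followed from \<open>\<alpha>\<close> too.\<close>

lemma optimal_of_supp:
  assumes "optimal \<alpha>" and "\<mu> \<in> weights" and "supp \<mu> \<subseteq> supp \<alpha>"
  shows "optimal \<mu>"
  unfolding optimal_def
proof (intro conjI ballI impI)
  fix \<nu> assume \<nu>: "\<nu> \<in> weights" "lincomb X a \<nu> = lincomb X a \<mu>" "\<nu> \<noteq> \<mu>"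
  then obtain y where "\<nu> y - \<mu> y \<noteq> 0"
    by fastforce
  show "P (\<lambda>x. \<nu> x - \<mu> x)"
  proof (rule optimal_direction [OF assms(1), where y = y])
    show "x \<in> supp \<alpha>" if "\<nu> x - \<mu> x < 0" for x
    proof (rule ccontr)
      assume "x \<notin> supp \<alpha>"
      then have "\<mu> x = 0"
        using assms(2,3) weights_notin_supp by blast
      then show False
        using that \<nu>(1) by (simp add: weights_def not_less [symmetric])
    qed
    show "\<nu> x - \<mu> x = 0" if "x \<notin> X" for x
      using that \<nu>(1) assms(2) by (simp add: weights_def)
  qed (use \<nu> \<open>\<nu> y - \<mu> y \<noteq> 0\<close> in \<open>simp_all add: lincomb_diff\<close>)
qed fact

lemma optimal_unique:
  assumes "optimal \<alpha>" and "optimal \<mu>" and "lincomb X a \<alpha> = lincomb X a \<mu>"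
  shows "\<alpha> = \<mu>"
proof (rule ccontr)
  assume "\<alpha> \<noteq> \<mu>"
  then have "P (\<lambda>x. \<alpha> x - \<mu> x)" "P (\<lambda>x. \<mu> x - \<alpha> x)"
    using assms unfolding optimal_def by auto
  then show False
    using P_asym [of "\<lambda>x. \<alpha> x - \<mu> x"] by simp
qed

text \<open>If the support carries a linear relation, follow it in the decreasing direction until a
  coefficient vanishes. The coefficients of the relation have sum zero by the height condition, so
  some coefficient does decrease. The support shrinks in each step.\<close>

lemma free_reduction:
  assumes "\<alpha> \<in> weights"
  shows "\<exists>\<mu>\<in>weights. free_family (supp \<mu>) \<and> lincomb X a \<mu> = lincomb X a \<alpha> \<and>
    (\<mu> = \<alpha> \<or> P (\<lambda>x. \<alpha> x - \<mu> x))"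
  using assms
proof (induction "card (supp \<alpha>)" arbitrary: \<alpha> rule: less_induct)
  case less
  show ?case
  proof (cases "free_family (supp \<alpha>)")
    case True
    then show ?thesis using less.prems by blast
  next
    case False
    then obtain \<delta>0 y where \<delta>0: "\<forall>x. x \<notin> supp \<alpha> \<longrightarrow> \<delta>0 x = 0" "lincomb X a \<delta>0 = 0" "\<delta>0 y \<noteq> 0"
      by (auto simp: free_family_def)
    have "P \<delta>0 \<or> P (\<lambda>x. - \<delta>0 x)"
      by (rule P_total [of _ y]) (use \<delta>0 in \<open>auto simp: supp_def\<close>)
    then obtain \<delta> where \<delta>: "\<forall>x. x \<notin> supp \<alpha> \<longrightarrow> \<delta> x = 0" "lincomb X a \<delta> = 0" "\<delta> y \<noteq> 0"
      "P (\<lambda>x. - \<delta> x)"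
    proof
      assume "P \<delta>0"
      moreover have "lincomb X a (\<lambda>x. - \<delta>0 x) = 0"
        using \<delta>0(2) lincomb_scale [of "-1" \<delta>0] by simp
      ultimately show thesis
        using \<delta>0 by (intro that [of "\<lambda>x. - \<delta>0 x"]) auto
    qed (use \<delta>0 that in blast)
    define N where "N = {x \<in> supp \<alpha>. \<delta> x < 0}"
    have "sum \<delta> X = 0"
      using height_lincomb [of \<delta>] \<delta>(2) linear_height by (simp add: linear_0)
    have "N \<noteq> {}"
    proof
      assume "N = {}"
      have "0 \<le> \<delta> x" for x
      proof (cases "x \<in> supp \<alpha>")
        case True
        then have "\<not> \<delta> x < 0"
          using \<open>N = {}\<close> unfolding N_def by blast
        then show ?thesis by simp
      qed (simp add: \<delta>(1))
      then have "\<forall>x\<in>X. \<delta> x = 0"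
        using sum_nonneg_eq_0_iff [OF finite_X, of \<delta>] \<open>sum \<delta> X = 0\<close> by blast
      moreover have "y \<in> X"
        using \<delta>(1,3) unfolding supp_def by blast
      ultimately show False
        using \<delta>(3) by blast
    qed
    moreover have "finite N"
      using supp_finite by (simp add: N_def)
    ultimately obtain z where "is_arg_min (\<lambda>x. \<alpha> x / - \<delta> x) (\<lambda>x. x \<in> N) z"
      using ex_is_arg_min_if_finite [of N] by blast
    then have z: "z \<in> N" "\<And>x. x \<in> N \<Longrightarrow> \<alpha> z / - \<delta> z \<le> \<alpha> x / - \<delta> x"
      unfolding is_arg_min_linorder by blast+
    \<comment> \<open>The step length at which the first coefficient vanishes.\<close>
    define c where "c = \<alpha> z / - \<delta> z"
    define \<mu> where "\<mu> x = \<alpha> x + c * \<delta> x" for x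
    have "0 < c"
      using z(1) weights_pos [OF less.prems] by (auto simp: c_def N_def divide_pos_neg)
    have "\<mu> x \<ge> 0" for x
    proof (cases "x \<in> N")
      case True
      then have "\<delta> x < 0" "c \<le> \<alpha> x / - \<delta> x"
        using z(2) by (auto simp: N_def c_def)
      then have "c * - \<delta> x \<le> \<alpha> x"
        by (metis neg_0_less_iff_less pos_le_divide_eq)
      then show ?thesis
        by (simp add: \<mu>_def)
    next
      case False
      then have "0 \<le> \<delta> x"
        using \<delta>(1) unfolding N_def by (metis (mono_tags, lifting) linorder_not_le mem_Collect_eq order_refl)
      then show ?thesis
        using \<open>0 < c\<close> less.prems by (simp add: \<mu>_def weights_def)
    qed
    moreover have "\<mu> x = 0" if "x \<notin> X" for x
      using that less.prems \<delta>(1) by (simp add: \<mu>_def weights_def supp_def)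
    ultimately have \<mu>: "\<mu> \<in> weights"
      by (simp add: weights_def)
    have "\<mu> z = 0"
      using z(1) by (auto simp: \<mu>_def c_def N_def)
    moreover have "supp \<mu> \<subseteq> supp \<alpha>"
      using \<delta>(1) less.prems by (auto simp: supp_def \<mu>_def)
    moreover have "z \<in> supp \<alpha>"
      using z(1) by (simp add: N_def)
    ultimately have "supp \<mu> \<subset> supp \<alpha>"
      by (auto simp: supp_def)
    then have "card (supp \<mu>) < card (supp \<alpha>)"
      by (rule psubset_card_mono [OF supp_finite])
    from less.hyps [OF this \<mu>] obtain \<kappa> where \<kappa>: "\<kappa> \<in> weights" "free_family (supp \<kappa>)"
      "lincomb X a \<kappa> = lincomb X a \<mu>" "\<kappa> = \<mu> \<or> P (\<lambda>x. \<mu> x - \<kappa> x)"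
      by blast
    have step: "P (\<lambda>x. \<alpha> x - \<mu> x)"
      using P_scale [OF \<open>0 < c\<close> \<delta>(4)] by (simp add: \<mu>_def)
    then have "P (\<lambda>x. \<alpha> x - \<kappa> x)"
      using \<kappa>(4) P_add [OF step, of "\<lambda>x. \<mu> x - \<kappa> x"] by auto
    moreover have "lincomb X a \<mu> = lincomb X a \<alpha>"
      using \<delta>(2) lincomb_add [of \<alpha> "\<lambda>x. c * \<delta> x"] by (simp add: \<mu>_def [abs_def] lincomb_scale)
    ultimately show ?thesis
      using \<kappa> by metis
  qed
qed

text \<open>By \<open>free_reduction\<close> only weights with free support compete, and there are finitely many of
  these with a given combination, at most one for each support.\<close>

lemma optimal_exists:
  assumes "\<alpha> \<in> weights"
  shows "\<exists>\<mu>. optimal \<mu> \<and> lincomb X a \<mu> = lincomb X a \<alpha>"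
proof -
  define R where "R = {\<mu> \<in> weights. free_family (supp \<mu>) \<and> lincomb X a \<mu> = lincomb X a \<alpha>}"
  have "inj_on supp R"
  proof (rule inj_onI, rule ext)
    fix \<mu> \<nu> x assume *: "\<mu> \<in> R" "\<nu> \<in> R" "supp \<mu> = supp \<nu>"
    have "lincomb X a (\<lambda>x. \<mu> x - \<nu> x) = 0"
      using * by (simp add: R_def lincomb_diff)
    moreover have "\<forall>x. x \<notin> supp \<mu> \<longrightarrow> \<mu> x - \<nu> x = 0"
      using * by (auto simp: R_def weights_notin_supp)
    moreover have "free_family (supp \<mu>)"
      using *(1) by (simp add: R_def)
    ultimately have "\<mu> x - \<nu> x = 0"
      using free_familyD [of "supp \<mu>" "\<lambda>x. \<mu> x - \<nu> x" x] by simp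
    then show "\<mu> x = \<nu> x" by simp
  qed
  moreover have "supp ` R \<subseteq> Pow X"
    by (auto simp: supp_def)
  ultimately have "finite R"
    using finite_X by (meson finite_Pow_iff finite_imageD finite_subset)
  have "R \<noteq> {}"
    using free_reduction [OF assms] by (auto simp: R_def)
  have trans: "P (\<lambda>x. \<mu> x - \<kappa> x)" if "P (\<lambda>x. \<mu> x - \<nu> x)" "P (\<lambda>x. \<nu> x - \<kappa> x)" for \<mu> \<nu> \<kappa>
    using P_add [OF that] by simp
  \<comment> \<open>A nonempty finite set has a least element in the total order.\<close>
  have "\<exists>\<mu>\<in>S. \<forall>\<nu>\<in>S. \<nu> \<noteq> \<mu> \<longrightarrow> P (\<lambda>x. \<nu> x - \<mu> x)" if "finite S" "S \<noteq> {}" "S \<subseteq> R" for S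
    using that
  proof (induction S rule: finite_ne_induct)
    case (insert \<kappa> S)
    then obtain \<mu> where \<mu>: "\<mu> \<in> S" "\<And>\<nu>. \<nu> \<in> S \<Longrightarrow> \<nu> \<noteq> \<mu> \<Longrightarrow> P (\<lambda>x. \<nu> x - \<mu> x)"
      by blast
    have "\<kappa> \<noteq> \<mu>"
      using \<mu>(1) insert.hyps by blast
    then obtain y where "\<kappa> y - \<mu> y \<noteq> 0"
      by fastforce
    moreover have "\<kappa> x - \<mu> x = 0" if "x \<notin> X" for x
      using that insert.prems \<mu>(1) by (auto simp: R_def weights_def)
    ultimately consider "P (\<lambda>x. \<kappa> x - \<mu> x)" | "P (\<lambda>x. \<mu> x - \<kappa> x)"
      using P_total [of "\<lambda>x. \<kappa> x - \<mu> x" y] by auto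
    then show ?case
    proof cases
      case 1
      then show ?thesis using \<mu> by blast
    next
      case 2
      have "P (\<lambda>x. \<nu> x - \<kappa> x)" if "\<nu> \<in> S" for \<nu>
        using 2 \<mu>(2) [OF that] trans by (cases "\<nu> = \<mu>") blast+
      then show ?thesis by blast
    qed
  qed blast
  from this [OF \<open>finite R\<close> \<open>R \<noteq> {}\<close>] obtain \<mu> where
    \<mu>: "\<mu> \<in> R" "\<And>\<nu>. \<nu> \<in> R \<Longrightarrow> \<nu> \<noteq> \<mu> \<Longrightarrow> P (\<lambda>x. \<nu> x - \<mu> x)"
    by blast
  have "optimal \<mu>"
    unfolding optimal_def
  proof (intro conjI ballI impI)
    fix \<nu> assume \<nu>: "\<nu> \<in> weights" "lincomb X a \<nu> = lincomb X a \<mu>" "\<nu> \<noteq> \<mu>"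
    obtain \<kappa> where \<kappa>: "\<kappa> \<in> weights" "free_family (supp \<kappa>)" "lincomb X a \<kappa> = lincomb X a \<nu>"
      "\<kappa> = \<nu> \<or> P (\<lambda>x. \<nu> x - \<kappa> x)"
      using free_reduction [OF \<nu>(1)] by blast
    then have "\<kappa> \<in> R"
      using \<nu>(2) \<mu>(1) by (simp add: R_def)
    show "P (\<lambda>x. \<nu> x - \<mu> x)"
    proof (cases "\<kappa> = \<mu>")
      case True
      then show ?thesis using \<kappa>(4) \<nu>(3) by blast
    next
      case False
      then have "P (\<lambda>x. \<kappa> x - \<mu> x)"
        using \<mu>(2) \<open>\<kappa> \<in> R\<close> by blast
      then show ?thesis
        using \<kappa>(4) trans [of \<nu> \<kappa> \<mu>] by blast
    qed
  qed (use \<mu>(1) in \<open>simp add: R_def\<close>)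
  moreover have "lincomb X a \<mu> = lincomb X a \<alpha>"
    using \<mu>(1) by (simp add: R_def)
  ultimately show ?thesis
    by blast
qed

end

section \<open>Spanning simplices in faces\<close>

text \<open>Induction on the number of subspaces. To avoid one more subspace, move along a point outside
  of it; each subspace is met by at most one of the positions \<open>0, 1, 2, \<dots>\<close>.\<close>

lemma avoid_subspaces:
  fixes a :: "'x \<Rightarrow> 'v::real_vector"
  assumes "finite \<U>" and "finite F"
    and "\<And>U. U \<in> \<U> \<Longrightarrow> subspace U" and "\<And>U. U \<in> \<U> \<Longrightarrow> \<exists>x\<in>F. a x \<notin> U"
  shows "\<exists>\<mu>. (\<forall>x. 0 \<le> \<mu> x) \<and> (\<forall>x. x \<notin> F \<longrightarrow> \<mu> x = 0) \<and> (\<forall>U\<in>\<U>. lincomb F a \<mu> \<notin> U)"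
  using assms(1,3,4)
proof (induction \<U> rule: finite_induct)
  case empty
  show ?case
    by (intro exI [of _ "\<lambda>_. 0"]) simp
next
  case (insert U \<U>)
  then obtain \<mu> where \<mu>: "\<forall>x. 0 \<le> \<mu> x" "\<forall>x. x \<notin> F \<longrightarrow> \<mu> x = 0" "\<forall>W\<in>\<U>. lincomb F a \<mu> \<notin> W"
    by auto
  obtain x where x: "x \<in> F" "a x \<notin> U"
    using insert.prems by blast
  define p where "p s = lincomb F a \<mu> + real s *\<^sub>R a x" for s :: nat
  have "finite {s. p s \<in> W}" if W: "W \<in> insert U \<U>" for W
  proof -
    have sub: "subspace W"
      using W insert.prems by blast
    have "s = r" if "p s \<in> W" "p r \<in> W" for s r
    proof (rule ccontr)
      assume "s \<noteq> r"
      have "p s - p r \<in> W"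
        using sub that by (rule subspace_diff)
      moreover have "a x = (1 / (real s - real r)) *\<^sub>R (p s - p r)"
        using \<open>s \<noteq> r\<close> by (simp add: p_def scaleR_left_diff_distrib [symmetric])
      ultimately have "a x \<in> W"
        using sub subspace_scale by metis
      then have "W \<in> \<U>"
        using W x(2) by blast
      have "p s - real s *\<^sub>R a x \<in> W"
        using sub that(1) \<open>a x \<in> W\<close> by (simp add: subspace_diff subspace_scale)
      then show False
        using \<mu>(3) \<open>W \<in> \<U>\<close> by (simp add: p_def)
    qed
    then have "{s. p s \<in> W} = {} \<or> (\<exists>s. {s. p s \<in> W} \<subseteq> {s})"
      by blast
    then show ?thesis
      using finite_subset by auto
  qed
  then have "finite (\<Union>W\<in>insert U \<U>. {s. p s \<in> W})"
    using insert.hyps(1) by blast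
  then obtain s where s: "s \<notin> (\<Union>W\<in>insert U \<U>. {s. p s \<in> W})"
    using ex_new_if_finite infinite_UNIV_nat by blast
  define \<nu> where "\<nu> y = \<mu> y + (if y = x then real s else 0)" for y
  have "lincomb F a \<nu> = p s"
    using assms(2) x(1)
    by (simp add: lincomb_def p_def \<nu>_def scaleR_left_distrib sum.distrib if_distrib [of "\<lambda>c. c *\<^sub>R _"] cong: if_cong)
  moreover have "\<forall>x. 0 \<le> \<nu> x" "\<forall>x. x \<notin> F \<longrightarrow> \<nu> x = 0"
    using \<mu>(1,2) x(1) by (auto simp: \<nu>_def)
  ultimately show ?case
    using s by (intro exI [of _ \<nu>]) auto
qed

context weighted_configuration
begin

lemma indicator_in_weights: "\<sigma> \<subseteq> X \<Longrightarrow> indicat_real \<sigma> \<in> weights"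
  by (auto simp: weights_def indicator_def)

lemma supp_indicator: "\<sigma> \<subseteq> X \<Longrightarrow> supp (indicat_real \<sigma>) = \<sigma>"
  by (auto simp: supp_def indicator_def)

lemma supp_in_simplices:
  assumes "optimal \<alpha>" and "supp \<alpha> \<noteq> {}"
  shows "supp \<alpha> \<in> simplices"
proof -
  have "supp \<alpha> \<subseteq> X"
    by (auto simp: supp_def)
  then have "optimal (indicat_real (supp \<alpha>))"
    using optimal_of_supp [OF assms(1) indicator_in_weights] supp_indicator by simp
  then show ?thesis
    using assms(2) \<open>supp \<alpha> \<subseteq> X\<close> by (simp add: simplices_def)
qed

lemma free_family_simplex: "\<sigma> \<in> simplices \<Longrightarrow> free_family \<sigma>"
  using free_family_optimal [of "indicat_real \<sigma>"] supp_indicator by (simp add: simplices_def)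

lemma free_family_independent:
  assumes "\<sigma> \<subseteq> X" and "free_family \<sigma>"
  shows "inj_on a \<sigma>" and "independent (a ` \<sigma>)"
proof -
  have fin: "finite \<sigma>"
    using assms(1) finite_X finite_subset by blast
  have lincomb_on: "lincomb X a \<delta> = lincomb \<sigma> a \<delta>" if "\<And>x. x \<notin> \<sigma> \<Longrightarrow> \<delta> x = 0" for \<delta>
    unfolding lincomb_def by (rule sum.mono_neutral_right) (use assms(1) finite_X that in auto)
  show inj: "inj_on a \<sigma>"
  proof (rule inj_onI, rule ccontr)
    fix x y assume *: "x \<in> \<sigma>" "y \<in> \<sigma>" "a x = a y" "x \<noteq> y"
    define \<delta> where "\<delta> z = (if z = x then 1 else 0) - (if z = y then 1 else 0 :: real)" for z
    have "lincomb \<sigma> a \<delta> = a x - a y"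
      using fin *(1,2) by (simp add: lincomb_def \<delta>_def scaleR_left_diff_distrib sum_subtractf
          if_distrib [of "\<lambda>c. c *\<^sub>R _"] cong: if_cong)
    moreover have out: "\<delta> z = 0" if "z \<notin> \<sigma>" for z
      using that *(1,2) by (auto simp: \<delta>_def)
    ultimately have "lincomb X a \<delta> = 0"
      using lincomb_on [of \<delta>] *(3) by simp
    then have "\<delta> x = 0"
      using free_familyD [OF assms(2)] out by blast
    then show False
      using *(4) by (simp add: \<delta>_def)
  qed
  show "independent (a ` \<sigma>)"
  proof
    assume "dependent (a ` \<sigma>)"
    then obtain u where u: "\<exists>v\<in>a ` \<sigma>. u v \<noteq> 0" "(\<Sum>v\<in>a ` \<sigma>. u v *\<^sub>R v) = 0"
      using fin by (auto simp: dependent_finite)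
    then obtain y where y: "y \<in> \<sigma>" "u (a y) \<noteq> 0"
      by blast
    define \<delta> where "\<delta> x = (if x \<in> \<sigma> then u (a x) else 0)" for x
    have "lincomb X a \<delta> = (\<Sum>x\<in>\<sigma>. u (a x) *\<^sub>R a x)"
      by (subst lincomb_on) (auto simp: lincomb_def \<delta>_def)
    also have "\<dots> = 0"
      using u(2) inj by (simp add: sum.reindex)
    finally have "\<delta> y = 0"
      using free_familyD [OF assms(2), of \<delta> y] by (simp add: \<delta>_def)
    then show False
      using y by (simp add: \<delta>_def)
  qed
qed

lemma card_simplex: "\<sigma> \<in> simplices \<Longrightarrow> card \<sigma> = dim (a ` \<sigma>)"
  using free_family_independent [of \<sigma>] free_family_simplex [of \<sigma>]
  by (simp add: simplices_def dim_eq_card_independent card_image)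

lemma lincomb_in_span: "\<alpha> \<in> weights \<Longrightarrow> lincomb X a \<alpha> \<in> span (a ` supp \<alpha>)"
proof -
  assume "\<alpha> \<in> weights"
  then have "lincomb X a \<alpha> = (\<Sum>x\<in>supp \<alpha>. \<alpha> x *\<^sub>R a x)"
    unfolding lincomb_def by (intro sum.mono_neutral_right) (auto simp: supp_def finite_X)
  then show ?thesis
    by (simp add: span_sum span_scale span_base)
qed

text \<open>Choose a combination of points of \<open>F\<close> outside all proper subspaces spanned by subsets of
  \<open>F\<close>. Its minimal representation stays in \<open>F\<close> by assumption, and so its support must span.\<close>

lemma full_simplex_in_face:
  assumes "F \<subseteq> X" and "F \<noteq> {}"
    and face: "\<And>\<alpha> \<mu>. optimal \<alpha> \<Longrightarrow> \<mu> \<in> weights \<Longrightarrow> supp \<mu> \<subseteq> F \<Longrightarrow>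
      lincomb X a \<alpha> = lincomb X a \<mu> \<Longrightarrow> supp \<alpha> \<subseteq> F"
  shows "\<exists>\<sigma>\<in>simplices. \<sigma> \<subseteq> F \<and> span (a ` \<sigma>) = span (a ` F)"
proof -
  have fin: "finite F"
    using assms(1) finite_X finite_subset by blast
  define \<U> where "\<U> = (\<lambda>\<tau>. span (a ` \<tau>)) ` {\<tau>. \<tau> \<subseteq> F \<and> span (a ` \<tau>) \<noteq> span (a ` F)}"
  have "\<exists>\<mu>. (\<forall>x. 0 \<le> \<mu> x) \<and> (\<forall>x. x \<notin> F \<longrightarrow> \<mu> x = 0) \<and> (\<forall>U\<in>\<U>. lincomb F a \<mu> \<notin> U)"
  proof (rule avoid_subspaces)
    show "finite \<U>"
      using fin by (simp add: \<U>_def)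
    fix U assume "U \<in> \<U>"
    then obtain \<tau> where \<tau>: "U = span (a ` \<tau>)" "\<tau> \<subseteq> F" "span (a ` \<tau>) \<noteq> span (a ` F)"
      by (auto simp: \<U>_def)
    then show "subspace U"
      by simp
    show "\<exists>x\<in>F. a x \<notin> U"
    proof (rule ccontr)
      assume "\<not> (\<exists>x\<in>F. a x \<notin> U)"
      then have "span (a ` F) \<subseteq> span (a ` \<tau>)"
        using \<tau>(1) by (intro span_minimal) auto
      moreover have "span (a ` \<tau>) \<subseteq> span (a ` F)"
        using \<tau>(2) by (intro span_mono) auto
      ultimately show False
        using \<tau>(3) by blast
    qed
  qed (use fin in auto)
  then obtain \<mu> where \<mu>: "\<forall>x. 0 \<le> \<mu> x" "\<forall>x. x \<notin> F \<longrightarrow> \<mu> x = 0" "\<forall>U\<in>\<U>. lincomb F a \<mu> \<notin> U"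
    by blast
  have \<mu>_weights: "\<mu> \<in> weights"
    using \<mu>(1,2) assms(1) by (auto simp: weights_def)
  have \<mu>_supp: "supp \<mu> \<subseteq> F"
    using \<mu>(2) by (auto simp: supp_def)
  have \<mu>_lincomb: "lincomb X a \<mu> = lincomb F a \<mu>"
    unfolding lincomb_def by (rule sum.mono_neutral_right) (use assms(1) finite_X \<mu>(2) in auto)
  obtain \<alpha> where \<alpha>: "optimal \<alpha>" "lincomb X a \<alpha> = lincomb X a \<mu>"
    using optimal_exists [OF \<mu>_weights] by blast
  have sub: "supp \<alpha> \<subseteq> F"
    using face [OF \<alpha>(1) \<mu>_weights \<mu>_supp \<alpha>(2)] .
  have "lincomb F a \<mu> \<in> span (a ` supp \<alpha>)"
    using lincomb_in_span [OF optimal_in_weights [OF \<alpha>(1)]] \<alpha>(2) \<mu>_lincomb by simp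
  then have full: "span (a ` supp \<alpha>) = span (a ` F)"
    using \<mu>(3) sub unfolding \<U>_def by blast
  have "supp \<alpha> \<noteq> {}"
  proof
    assume "supp \<alpha> = {}"
    obtain x where "x \<in> F"
      using assms(2) by blast
    then have "a x \<in> span (a ` supp \<alpha>)"
      unfolding full by (simp add: span_base)
    then have "a x = 0"
      using \<open>supp \<alpha> = {}\<close> by simp
    then have "height (a x) = 0"
      using linear_0 [OF linear_height] by simp
    moreover have "height (a x) = 1"
      using \<open>x \<in> F\<close> assms(1) by (intro height_a) blast
    ultimately show False
      by simp
  qed
  then show ?thesis
    using supp_in_simplices [OF \<alpha>(1)] sub full by (intro bexI [of _ "supp \<alpha>"] conjI)
qed

end

section \<open>Box points and the number of simplices\<close>

locale lattice_configuration = weighted_configuration X a height P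
  for X :: "'x set" and a :: "'x \<Rightarrow> 'v::real_vector" and height P +
  fixes \<Lambda> :: "'v set"
  assumes lattice_zero: "0 \<in> \<Lambda>"
    and lattice_diff: "y \<in> \<Lambda> \<Longrightarrow> z \<in> \<Lambda> \<Longrightarrow> y - z \<in> \<Lambda>"
    and lattice_a: "x \<in> X \<Longrightarrow> a x \<in> \<Lambda>"
    and lattice_height: "z \<in> \<Lambda> \<Longrightarrow> height z \<in> \<int>"
    and finite_level: "finite {z \<in> \<Lambda> \<inter> lincomb X a ` weights. height z = real t}"
begin

definition level :: "nat \<Rightarrow> 'v set" where
  "level t = {z \<in> \<Lambda> \<inter> lincomb X a ` weights. height z = real t}"

definition lattice_optimal :: "nat \<Rightarrow> ('x \<Rightarrow> real) set" where
  "lattice_optimal t = {\<alpha>. optimal \<alpha> \<and> lincomb X a \<alpha> \<in> \<Lambda> \<and> sum \<alpha> X = real t}"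

text \<open>Their combinations are the lattice points in the half-open parallelepipeds over the
  simplices, each parallelepiped containing the sum of its edges but no proper face through the
  origin.\<close>

definition box_points :: "('x \<Rightarrow> real) set" where
  "box_points = {\<beta>. optimal \<beta> \<and> lincomb X a \<beta> \<in> \<Lambda> \<and> (\<forall>x. \<beta> x \<le> 1) \<and> supp \<beta> \<noteq> {}}"

definition box_height :: "('x \<Rightarrow> real) \<Rightarrow> nat" where
  "box_height \<beta> = nat \<lfloor>sum \<beta> X\<rfloor>"

lemma lattice_add: "y \<in> \<Lambda> \<Longrightarrow> z \<in> \<Lambda> \<Longrightarrow> y + z \<in> \<Lambda>"
  using lattice_diff [of y "0 - z"] lattice_diff [of 0 z] lattice_zero by simp

lemma lattice_scale: "z \<in> \<Lambda> \<Longrightarrow> real n *\<^sub>R z \<in> \<Lambda>"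
  by (induction n) (simp_all add: lattice_zero lattice_add scaleR_left_distrib)

lemma lattice_lincomb_nat: "lincomb X a (\<lambda>x. real (n x)) \<in> \<Lambda>"
proof -
  have "(\<Sum>x\<in>Y. real (n x) *\<^sub>R a x) \<in> \<Lambda>" if "finite Y" "Y \<subseteq> X" for Y
    using that by (induction Y rule: finite_induct) (simp_all add: lattice_zero lattice_add lattice_scale lattice_a)
  then show ?thesis
    using finite_X by (simp add: lincomb_def)
qed

lemma bij_betw_lattice_optimal: "bij_betw (lincomb X a) (lattice_optimal t) (level t)"
  unfolding bij_betw_def
proof
  show "inj_on (lincomb X a) (lattice_optimal t)"
    by (rule inj_onI) (simp add: lattice_optimal_def optimal_unique)
  show "lincomb X a ` lattice_optimal t = level t"
  proof
    show "lincomb X a ` lattice_optimal t \<subseteq> level t"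
      by (auto simp: lattice_optimal_def level_def height_lincomb optimal_in_weights)
    show "level t \<subseteq> lincomb X a ` lattice_optimal t"
    proof
      fix z assume z: "z \<in> level t"
      then obtain \<alpha> where "\<alpha> \<in> weights" "z = lincomb X a \<alpha>"
        by (auto simp: level_def)
      then obtain \<mu> where \<mu>: "optimal \<mu>" "lincomb X a \<mu> = z"
        using optimal_exists by blast
      then have "sum \<mu> X = real t"
        using z height_lincomb [of \<mu>] by (simp add: level_def)
      then have "\<mu> \<in> lattice_optimal t"
        using \<mu> z by (simp add: lattice_optimal_def level_def)
      then show "z \<in> lincomb X a ` lattice_optimal t"
        using \<mu>(2) by blast
    qed
  qed
qed

lemma
  assumes "\<beta> \<in> box_points"
  shows sum_box: "sum \<beta> X = real (box_height \<beta>)"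
    and box_height_le: "box_height \<beta> \<le> card (supp \<beta>)"
    and box_height_pos: "1 \<le> box_height \<beta>"
    and box_pos: "x \<in> supp \<beta> \<Longrightarrow> 0 < \<beta> x"
    and box_le_one: "\<beta> x \<le> 1"
proof -
  have \<beta>: "\<beta> \<in> weights" "lincomb X a \<beta> \<in> \<Lambda>" "\<And>x. \<beta> x \<le> 1" "supp \<beta> \<noteq> {}"
    using assms by (auto simp: box_points_def optimal_in_weights)
  show "x \<in> supp \<beta> \<Longrightarrow> 0 < \<beta> x" and "\<beta> x \<le> 1" for x
    using \<beta> weights_pos by auto
  have sum_supp: "sum \<beta> X = sum \<beta> (supp \<beta>)"
    by (rule sum.mono_neutral_right) (auto simp: supp_def finite_X)
  have "0 < sum \<beta> (supp \<beta>)"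
    using \<beta>(1,4) supp_finite weights_pos by (intro sum_pos) auto
  moreover have "sum \<beta> X \<in> \<int>"
    using lattice_height [OF \<beta>(2)] by (simp add: height_lincomb)
  ultimately show sum: "sum \<beta> X = real (box_height \<beta>)"
    by (auto simp: sum_supp box_height_def elim!: Ints_cases)
  then show "1 \<le> box_height \<beta>"
    using \<open>0 < sum \<beta> (supp \<beta>)\<close> sum_supp by simp
  have "sum \<beta> (supp \<beta>) \<le> real (card (supp \<beta>))"
    using sum_mono [of "supp \<beta>" \<beta> "\<lambda>_. 1"] \<beta>(3) by simp
  then show "box_height \<beta> \<le> card (supp \<beta>)"
    using sum sum_supp by simp
qed

lemma finite_box: "finite box_points"
proof -
  have "box_points \<subseteq> (\<Union>t\<in>{..card X}. lattice_optimal t)"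
  proof
    fix \<beta> assume \<beta>: "\<beta> \<in> box_points"
    have "card (supp \<beta>) \<le> card X"
      using finite_X by (intro card_mono) (auto simp: supp_def)
    then have "box_height \<beta> \<le> card X"
      using box_height_le [OF \<beta>] by simp
    moreover have "\<beta> \<in> lattice_optimal (box_height \<beta>)"
      using \<beta> sum_box [OF \<beta>] by (simp add: box_points_def lattice_optimal_def)
    ultimately show "\<beta> \<in> (\<Union>t\<in>{..card X}. lattice_optimal t)"
      by blast
  qed
  moreover have "finite (lattice_optimal t)" for t
    using bij_betw_finite [OF bij_betw_lattice_optimal] finite_level by (simp add: level_def)
  ultimately show ?thesis
    by (meson finite_UN_I finite_atMost finite_subset)
qed

text \<open>The natural vectors that lift the box point \<open>\<beta>\<close> to height \<open>t\<close> within the cone over its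
  support.\<close>

definition shifts :: "nat \<Rightarrow> ('x \<Rightarrow> real) \<Rightarrow> ('x \<Rightarrow> nat) set" where
  "shifts t \<beta> = {n. (\<forall>x. x \<notin> supp \<beta> \<longrightarrow> n x = 0) \<and> sum n (supp \<beta>) + box_height \<beta> = t}"

text \<open>Each positive real is uniquely the sum of a number in \<open>{0<..1}\<close> and a natural number.
  Optimality only depends on the support, which neither step of this decomposition changes.\<close>

lemma bij_betw_box_shifts:
  assumes "0 < t"
  shows "bij_betw (\<lambda>(\<beta>, n) x. \<beta> x + real (n x)) (SIGMA \<beta>:box_points. shifts t \<beta>) (lattice_optimal t)"
  unfolding bij_betw_def
proof
  have zero_out: "\<beta> x = 0 \<and> n x = 0" if "\<beta> \<in> box_points" "n \<in> shifts t \<beta>" "x \<notin> supp \<beta>" for \<beta> n x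
    using that weights_notin_supp optimal_in_weights by (auto simp: box_points_def shifts_def)
  show "inj_on (\<lambda>(\<beta>, n) x. \<beta> x + real (n x)) (SIGMA \<beta>:box_points. shifts t \<beta>)"
  proof (rule inj_onI, clarify)
    fix \<beta> \<gamma> n m
    assume *: "\<beta> \<in> box_points" "n \<in> shifts t \<beta>" "\<gamma> \<in> box_points" "m \<in> shifts t \<gamma>"
      and eq: "(\<lambda>x. \<beta> x + real (n x)) = (\<lambda>x. \<gamma> x + real (m x))"
    have "\<beta> x = \<gamma> x \<and> n x = m x" for x
    proof -
      have eqx: "\<beta> x + real (n x) = \<gamma> x + real (m x)"
        using eq by meson
      consider "x \<in> supp \<beta>" "x \<in> supp \<gamma>" | "x \<notin> supp \<beta>" | "x \<notin> supp \<gamma>"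
        by blast
      then show ?thesis
      proof cases
        case 1
        then have "\<bar>real (n x) - real (m x)\<bar> < 1"
          using eqx box_pos [OF *(1), of x] box_pos [OF *(3), of x]
            box_le_one [OF *(1), of x] box_le_one [OF *(3), of x] by linarith
        then have "n x = m x"
          by linarith
        then show ?thesis using eqx by simp
      next
        case 2
        then show ?thesis
          using eqx zero_out [OF *(1,2)] box_pos [OF *(3), of x] zero_out [OF *(3,4), of x]
          by (cases "x \<in> supp \<gamma>") auto
      next
        case 3
        then show ?thesis
          using eqx zero_out [OF *(3,4)] box_pos [OF *(1), of x] zero_out [OF *(1,2), of x]
          by (cases "x \<in> supp \<beta>") auto
      qed
    qed
    then show "\<beta> = \<gamma> \<and> n = m"
      by blast
  qed
  show "(\<lambda>(\<beta>, n) x. \<beta> x + real (n x)) ` (SIGMA \<beta>:box_points. shifts t \<beta>) = lattice_optimal t"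
  proof
    show "(\<lambda>(\<beta>, n) x. \<beta> x + real (n x)) ` (SIGMA \<beta>:box_points. shifts t \<beta>) \<subseteq> lattice_optimal t"
    proof clarify
      fix \<beta> n assume *: "\<beta> \<in> box_points" "n \<in> shifts t \<beta>"
      have opt: "optimal \<beta>" "lincomb X a \<beta> \<in> \<Lambda>"
        using *(1) by (simp_all add: box_points_def)
      have n0: "n x = 0" if "x \<notin> supp \<beta>" for x
        using zero_out [OF *] that by blast
      have "(\<lambda>x. \<beta> x + real (n x)) \<in> weights"
        using optimal_in_weights [OF opt(1)] n0 by (auto simp: weights_def supp_def)
      moreover have "supp (\<lambda>x. \<beta> x + real (n x)) \<subseteq> supp \<beta>"
        using n0 by (auto simp: supp_def)
      ultimately have "optimal (\<lambda>x. \<beta> x + real (n x))"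
        using optimal_of_supp [OF opt(1)] by blast
      moreover have "lincomb X a (\<lambda>x. \<beta> x + real (n x)) \<in> \<Lambda>"
        by (simp add: lincomb_add lattice_add opt(2) lattice_lincomb_nat)
      moreover have "sum n X = sum n (supp \<beta>)"
        using n0 by (intro sum.mono_neutral_right) (auto simp: supp_def finite_X)
      then have "(\<Sum>x\<in>X. \<beta> x + real (n x)) = real t"
        using *(2) sum_box [OF *(1)]
        by (simp add: sum.distrib shifts_def of_nat_sum [symmetric] del: of_nat_sum)
      ultimately show "(\<lambda>x. \<beta> x + real (n x)) \<in> lattice_optimal t"
        by (simp add: lattice_optimal_def)
    qed
    show "lattice_optimal t \<subseteq> (\<lambda>(\<beta>, n) x. \<beta> x + real (n x)) ` (SIGMA \<beta>:box_points. shifts t \<beta>)"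
    proof
      fix \<alpha> assume "\<alpha> \<in> lattice_optimal t"
      then have \<alpha>: "optimal \<alpha>" "lincomb X a \<alpha> \<in> \<Lambda>" "sum \<alpha> X = real t"
        by (simp_all add: lattice_optimal_def)
      have w: "\<alpha> \<in> weights"
        using \<alpha>(1) by (rule optimal_in_weights)
      \<comment> \<open>The ceiling minus one, so that the remainder is in \<open>{0<..1}\<close> rather than in \<open>{0..<1}\<close>. Outside the
        support it is \<open>nat (- 1) = 0\<close>.\<close>
      define n where "n x = nat (\<lceil>\<alpha> x\<rceil> - 1)" for x
      define \<beta> where "\<beta> x = \<alpha> x - real (n x)" for x
      have out: "n x = 0 \<and> \<beta> x = 0" if "x \<notin> supp \<alpha>" for x
        using weights_notin_supp [OF w that] by (simp add: n_def \<beta>_def)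
      have inside: "0 < \<beta> x \<and> \<beta> x \<le> 1" if "x \<in> supp \<alpha>" for x
      proof -
        have "0 < \<alpha> x"
          using weights_pos [OF w that] .
        then have "real (n x) = of_int \<lceil>\<alpha> x\<rceil> - 1"
          by (simp add: n_def)
        then show ?thesis
          unfolding \<beta>_def by linarith
      qed
      have supp_eq: "supp \<beta> = supp \<alpha>"
        using inside out by (force simp: supp_def)
      have "\<beta> \<in> weights"
        using inside out unfolding weights_def supp_def
        by (smt (verit, best) mem_Collect_eq)
      then have "optimal \<beta>"
        using optimal_of_supp [OF \<alpha>(1)] supp_eq by blast
      moreover have "lincomb X a \<beta> \<in> \<Lambda>"
        using \<alpha>(2) lattice_diff lattice_lincomb_nat by (simp add: \<beta>_def [abs_def] lincomb_diff)
      moreover have "supp \<alpha> \<noteq> {}"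
      proof
        assume "supp \<alpha> = {}"
        then have "sum \<alpha> X = 0"
          by (intro sum.neutral) (auto simp: supp_def)
        then show False
          using \<alpha>(3) assms by simp
      qed
      moreover have "\<beta> x \<le> 1" for x
        using inside [of x] out [of x] by (cases "x \<in> supp \<alpha>") auto
      ultimately have "\<beta> \<in> box_points"
        using supp_eq by (simp add: box_points_def)
      moreover have "n \<in> shifts t \<beta>"
      proof -
        have "sum n X = sum n (supp \<beta>)"
          using out supp_eq by (intro sum.mono_neutral_right) (auto simp: supp_def finite_X)
        moreover have "sum \<alpha> X = sum \<beta> X + real (sum n X)"
          by (simp add: \<beta>_def sum_subtractf)
        ultimately have "real t = real (sum n (supp \<beta>) + box_height \<beta>)"
          using \<alpha>(3) sum_box [OF \<open>\<beta> \<in> box_points\<close>] by simp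
        then show ?thesis
          using out supp_eq unfolding shifts_def by (auto simp only: of_nat_eq_iff mem_Collect_eq)
      qed
      moreover have "\<alpha> = (\<lambda>(\<beta>, n) x. \<beta> x + real (n x)) (\<beta>, n)"
        by (simp add: \<beta>_def)
      ultimately show "\<alpha> \<in> (\<lambda>(\<beta>, n) x. \<beta> x + real (n x)) ` (SIGMA \<beta>:box_points. shifts t \<beta>)"
        by blast
    qed
  qed
qed

text \<open>In this form the count holds below the height of the box point too, where the binomial
  coefficient vanishes.\<close>

lemma card_shifts:
  assumes "\<beta> \<in> box_points"
  shows "card (shifts (Suc m) \<beta>) =
    (m + (card (supp \<beta>) - box_height \<beta>)) choose (card (supp \<beta>) - 1)"
proof -
  define c h where "c = card (supp \<beta>)" and "h = box_height \<beta>"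
  have ch: "1 \<le> h" "h \<le> c"
    using box_height_pos [OF assms] box_height_le [OF assms] by (simp_all add: c_def h_def)
  show ?thesis
  proof (cases "h \<le> Suc m")
    case True
    then have "shifts (Suc m) \<beta> =
        {n. (\<forall>x. x \<notin> supp \<beta> \<longrightarrow> n x = 0) \<and> sum n (supp \<beta>) = Suc m - h}"
      by (auto simp: shifts_def h_def)
    then have "card (shifts (Suc m) \<beta>) = (Suc m - h + c - 1) choose (Suc m - h)"
      using card_nat_weights [OF supp_finite] by (simp add: c_def)
    also have "\<dots> = (Suc m - h + c - 1) choose (c - 1)"
      using ch by (subst binomial_symmetric) auto
    also have "Suc m - h + c - 1 = m + (c - h)"
      using ch True by simp
    finally show ?thesis
      by (simp add: c_def h_def)
  next
    case False
    then have "shifts (Suc m) \<beta> = {}"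
      by (auto simp: shifts_def h_def)
    moreover have "(m + (c - h)) choose (c - 1) = 0"
      using ch False by (intro binomial_eq_0) simp
    ultimately show ?thesis
      by (simp add: c_def h_def)
  qed
qed

text \<open>The number of lattice points at height \<open>m + 1\<close> is a sum of binomials with one summand for
  each box point. The \<open>k\<close>-th difference of a summand is a binomial coefficient or zero, and it is
  \<open>1\<close> for the indicator function of a simplex with \<open>k + 1\<close> vertices.\<close>

lemma card_simplices_le:
  "int (card {\<sigma> \<in> simplices. card \<sigma> = Suc k})
     \<le> (fdiff ^^ k) (\<lambda>m. int (card (level (Suc m)))) 0"
proof -
  let ?c = "\<lambda>\<beta>. card (supp \<beta>)" and ?h = box_height
  let ?term = "\<lambda>\<beta>. if k \<le> ?c \<beta> - 1 then int ((?c \<beta> - ?h \<beta>) choose (?c \<beta> - 1 - k)) else 0"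
  have level: "int (card (level (Suc m)))
      = (\<Sum>\<beta>\<in>box_points. int ((m + (?c \<beta> - ?h \<beta>)) choose (?c \<beta> - 1)))" for m
  proof -
    have fin: "finite (shifts (Suc m) \<beta>)" if "\<beta> \<in> box_points" for \<beta>
    proof -
      have "shifts (Suc m) \<beta> \<subseteq> {n. (\<forall>x. x \<notin> supp \<beta> \<longrightarrow> n x = 0) \<and> (\<forall>x. x \<in> supp \<beta> \<longrightarrow> n x \<in> {..Suc m})}"
      proof clarify
        fix n assume "n \<in> shifts (Suc m) \<beta>"
        then have "sum n (supp \<beta>) \<le> Suc m" "\<forall>x. x \<notin> supp \<beta> \<longrightarrow> n x = 0"
          by (auto simp: shifts_def)
        then show "(\<forall>x. x \<notin> supp \<beta> \<longrightarrow> n x = 0) \<and> (\<forall>x. x \<in> supp \<beta> \<longrightarrow> n x \<in> {..Suc m})"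
          using member_le_sum [of _ "supp \<beta>" n] supp_finite by (meson atMost_iff le_trans zero_le)
      qed
      moreover have "finite {n. (\<forall>x. x \<notin> supp \<beta> \<longrightarrow> n x = 0) \<and> (\<forall>x. x \<in> supp \<beta> \<longrightarrow> n x \<in> {..Suc m})}"
        using finite_set_of_finite_funs [OF supp_finite [of \<beta>] finite_atMost [of "Suc m"], of 0]
        by (rule rev_finite_subset) auto
      ultimately show ?thesis
        by (rule finite_subset)
    qed
    have "card (level (Suc m)) = card (SIGMA \<beta>:box_points. shifts (Suc m) \<beta>)"
      using bij_betw_same_card [OF bij_betw_lattice_optimal [of "Suc m"]]
        bij_betw_same_card [OF bij_betw_box_shifts [of "Suc m"]] by simp
    also have "\<dots> = (\<Sum>\<beta>\<in>box_points. card (shifts (Suc m) \<beta>))"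
      using finite_box fin by (intro card_SigmaI) auto
    finally show ?thesis
      by (simp add: card_shifts)
  qed
  have terms: "(fdiff ^^ k) (\<lambda>m. int (card (level (Suc m)))) 0 = (\<Sum>\<beta>\<in>box_points. ?term \<beta>)"
    unfolding level funpow_fdiff_sum funpow_fdiff_binomial add_0 ..
  define S where "S = {\<sigma> \<in> simplices. card \<sigma> = Suc k}"
  have S: "\<sigma> \<subseteq> X" "card \<sigma> = Suc k" "\<sigma> \<in> simplices" if "\<sigma> \<in> S" for \<sigma>
    using that by (auto simp: S_def simplices_def)
  have ind_box: "indicat_real \<sigma> \<in> box_points" if "\<sigma> \<in> S" for \<sigma>
  proof -
    have "indicat_real \<sigma> = (\<lambda>x. real (if x \<in> \<sigma> then 1 else 0))"
      by (auto simp: indicator_def)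
    then have "lincomb X a (indicat_real \<sigma>) \<in> \<Lambda>"
      using lattice_lincomb_nat by metis
    then show ?thesis
      using S [OF that] supp_indicator [of \<sigma>] by (auto simp: box_points_def simplices_def indicator_def)
  qed
  have term_one: "?term (indicat_real \<sigma>) = 1" if "\<sigma> \<in> S" for \<sigma>
  proof -
    have "sum (indicat_real \<sigma>) X = real (Suc k)"
      using S [OF that] finite_X by (simp add: indicator_def sum.If_cases Int_absorb1)
    then have "box_height (indicat_real \<sigma>) = Suc k"
      by (simp only: box_height_def) simp
    then show ?thesis
      using S [OF that] by (simp add: supp_indicator)
  qed
  have inj: "inj_on indicat_real S"
    using S(1) supp_indicator by (metis inj_onI)
  have "int (card S) = (\<Sum>\<sigma>\<in>S. ?term (indicat_real \<sigma>))"
    using term_one by simp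
  also have "\<dots> = (\<Sum>\<beta>\<in>indicat_real ` S. ?term \<beta>)"
    by (simp only: sum.reindex [OF inj] comp_def)
  also have "\<dots> \<le> (\<Sum>\<beta>\<in>box_points. ?term \<beta>)"
    using ind_box finite_box by (intro sum_mono2) auto
  finally show ?thesis
    by (simp add: terms S_def)
qed

end

section \<open>Lower faces of configurations in a dilated simplex\<close>

text \<open>The points \<open>pt x\<close>, lifted to height \<open>\<omega> x\<close>, that lie on the lower supporting hyperplane
  with slope \<open>- w\<close>. The cells of the regular subdivision defined by \<open>\<omega>\<close> are the sets of this form.\<close>

definition lower_face :: "'x set \<Rightarrow> ('x \<Rightarrow> real) \<Rightarrow> ('x \<Rightarrow> real ^ 'n) \<Rightarrow> real ^ 'n \<Rightarrow> 'x set" where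
  "lower_face X \<omega> pt w = {x \<in> X. \<forall>y\<in>X. \<omega> x + w \<bullet> pt x \<le> \<omega> y + w \<bullet> pt y}"

definition dilated_simplex :: "nat \<Rightarrow> (real ^ 'n::finite) set" where
  "dilated_simplex N = {q. (\<forall>i. q $ i \<in> \<nat>) \<and> (\<Sum>i\<in>UNIV. q $ i) = real N}"

lemma card_dilated_simplex:
  "finite (dilated_simplex N :: (real ^ 'n::finite) set)"
  "card (dilated_simplex N :: (real ^ 'n) set) = (N + CARD('n) - 1) choose (CARD('n) - 1)"
proof -
  define A where "A = {f :: 'n \<Rightarrow> nat. (\<forall>x. x \<notin> UNIV \<longrightarrow> f x = 0) \<and> sum f UNIV = N}"
  have bij: "bij_betw (\<lambda>f. \<chi> i. real (f i)) A (dilated_simplex N)"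
    unfolding bij_betw_def
  proof
    show "inj_on (\<lambda>f. \<chi> i. real (f i)) A"
      by (rule inj_onI) (auto simp: vec_eq_iff)
    show "(\<lambda>f. \<chi> i. real (f i)) ` A = dilated_simplex N"
    proof
      show "(\<lambda>f. \<chi> i. real (f i)) ` A \<subseteq> dilated_simplex N"
        by (auto simp: A_def dilated_simplex_def of_nat_sum [symmetric] simp del: of_nat_sum)
      show "dilated_simplex N \<subseteq> (\<lambda>f. \<chi> i. real (f i)) ` A"
      proof
        fix q :: "real ^ 'n" assume q: "q \<in> dilated_simplex N"
        then have "\<forall>i. \<exists>k. q $ i = real k"
          by (auto simp: dilated_simplex_def Nats_def)
        then obtain f where f: "\<And>i. q $ i = real (f i)"
          by metis
        then have "real (sum f UNIV) = real N"
          using q by (simp add: dilated_simplex_def)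
        then have "f \<in> A"
          unfolding A_def by (simp only: of_nat_eq_iff) simp
        moreover have "q = (\<chi> i. real (f i))"
          by (simp add: vec_eq_iff f)
        ultimately show "q \<in> (\<lambda>f. \<chi> i. real (f i)) ` A"
          by blast
      qed
    qed
  qed
  have card: "card A = (N + CARD('n) - 1) choose N"
    unfolding A_def by (rule card_nat_weights) simp
  have sym: "(N + CARD('n) - 1) choose N = (N + CARD('n) - 1) choose (CARD('n) - 1)"
  proof -
    have "N \<le> N + CARD('n) - 1"
      using zero_less_card_finite [where 'a = 'n] by linarith
    from binomial_symmetric [OF this] show ?thesis by simp
  qed
  have "finite A"
  proof -
    have "f i \<le> N" if "f \<in> A" for f i
      using member_le_sum [of i UNIV f] that by (simp add: A_def)
    then have "A \<subseteq> PiE UNIV (\<lambda>_. {..N})"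
      by (simp add: PiE_def Pi_def subset_iff)
    moreover have "finite (PiE (UNIV :: 'n set) (\<lambda>_. {..N}))"
      by (simp add: finite_PiE)
    ultimately show ?thesis
      by (rule finite_subset)
  qed
  then show "finite (dilated_simplex N :: (real ^ 'n::finite) set)"
    using bij_betw_finite [OF bij] by simp
  show "card (dilated_simplex N :: (real ^ 'n) set) = (N + CARD('n) - 1) choose (CARD('n) - 1)"
    unfolding bij_betw_same_card [OF bij, symmetric] card sym ..
qed

text \<open>After subtracting one point, the affine span of \<open>A\<close> becomes the linear span of differences
  in the hyperplane at height \<open>0\<close>, and the point at height \<open>1\<close> adds one dimension.\<close>

lemma dim_homogenization:
  fixes A :: "(real ^ 'n::finite) set"
  assumes "A \<noteq> {}"
  shows "int (dim ((\<lambda>q. (q, 1 :: real)) ` A)) = aff_dim A + 1"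
proof -
  obtain q0 where q0: "q0 \<in> A"
    using assms by blast
  define B where "B = (\<lambda>q. q - q0) ` A"
  define lift :: "real ^ 'n \<Rightarrow> (real ^ 'n) \<times> real" where "lift q = (q, 0)" for q
  have lift: "linear lift" "inj lift"
    by (auto simp: lift_def [abs_def] linear_iff inj_on_def)
  have "span ((\<lambda>q. (q, 1 :: real)) ` A) = span (insert (q0, 1) (lift ` B))"
  proof (rule subset_antisym; rule span_minimal)
    show "(\<lambda>q. (q, 1 :: real)) ` A \<subseteq> span (insert (q0, 1) (lift ` B))"
    proof clarify
      fix q assume "q \<in> A"
      then have "lift (q - q0) \<in> span (insert (q0, 1) (lift ` B))"
        by (intro span_base) (auto simp: B_def)
      moreover have "(q0, 1) \<in> span (insert (q0, 1) (lift ` B))"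
        by (simp add: span_base)
      ultimately have "lift (q - q0) + (q0, 1) \<in> span (insert (q0, 1) (lift ` B))"
        by (rule span_add)
      then show "(q, 1) \<in> span (insert (q0, 1) (lift ` B))"
        by (simp add: lift_def)
    qed
    show "insert (q0, 1) (lift ` B) \<subseteq> span ((\<lambda>q. (q, 1 :: real)) ` A)"
    proof -
      have "lift (q - q0) \<in> span ((\<lambda>q. (q, 1 :: real)) ` A)" if "q \<in> A" for q
      proof -
        have "(q, 1) - (q0, 1) \<in> span ((\<lambda>q. (q, 1 :: real)) ` A)"
          using that q0 by (intro span_diff span_base) auto
        then show ?thesis
          by (simp add: lift_def)
      qed
      moreover have "(q0, 1) \<in> span ((\<lambda>q. (q, 1 :: real)) ` A)"
        using q0 by (intro span_base) auto
      ultimately show ?thesis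
        by (auto simp: B_def)
    qed
  qed auto
  then have "dim ((\<lambda>q. (q, 1 :: real)) ` A) = dim (insert (q0, 1) (lift ` B))"
    by (metis dim_span)
  also have "\<dots> = dim (lift ` B) + 1"
  proof -
    have "span (lift ` B) \<subseteq> {z. snd z = 0}"
      by (rule span_minimal) (auto simp: lift_def subspace_def)
    then have "(q0, 1) \<notin> span (lift ` B)"
      by auto
    then show ?thesis
      by (simp add: dim_insert)
  qed
  also have "dim (lift ` B) = dim B"
    using lift by (intro dim_image_eq) (auto intro: inj_on_subset)
  also have "int (dim B + 1) = aff_dim A + 1"
    using aff_dim_eq_dim_subtract [OF hull_inc [OF q0]] by (simp add: B_def)
  finally show ?thesis .
qed

text \<open>The points of the configuration are put at height \<open>1\<close>, and the vertices \<open>N e\<^sub>i\<close> of the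
  simplex are added so that the cone contains all nonnegative vectors of the right degree. The
  order compares the weight on these added vertices first, then the lifting function, and breaks
  ties arbitrarily. Thus the minimal representation of a combination of points of a lower face
  uses only points of this face.\<close>

lemma card_lower_faces_le:
  fixes pt :: "'x \<Rightarrow> real ^ 'n::finite"
  assumes "finite X" and pts: "\<And>x. x \<in> X \<Longrightarrow> pt x \<in> dilated_simplex N"
  shows "int (card {F \<in> range (lower_face X \<omega> pt). aff_dim (pt ` F) = int k})
    \<le> (fdiff ^^ k) (\<lambda>m. int ((N * Suc m + CARD('n) - 1) choose (CARD('n) - 1))) 0"
proof -
  define Y where "Y = Inl ` X \<union> Inr ` (UNIV :: 'n set)"
  define p where "p y = (case y of Inl x \<Rightarrow> pt x | Inr i \<Rightarrow> real N *\<^sub>R axis i 1)" for y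
  define a where "a y = (p y, 1 :: real)" for y
  define \<eta> where "\<eta> y = (case y of Inl x \<Rightarrow> \<omega> x | Inr i \<Rightarrow> 0)" for y :: "'x + 'n"
  define g where "g y = (case y of Inl x \<Rightarrow> 0 | Inr i \<Rightarrow> (1 :: real))" for y :: "'x + 'n"
  define \<Lambda> where "\<Lambda> = {z :: (real ^ 'n) \<times> real. (\<forall>i. fst z $ i \<in> \<int>) \<and> snd z \<in> \<int>}"
  have finY: "finite Y"
    using assms(1) by (simp add: Y_def)
  obtain P0 where P0: "total_cone Y P0"
    using total_cone_exists [OF finY] by blast
  define P1 where "P1 \<delta> \<longleftrightarrow> 0 < (\<Sum>y\<in>Y. \<eta> y * \<delta> y) \<or> (\<Sum>y\<in>Y. \<eta> y * \<delta> y) = 0 \<and> P0 \<delta>" for \<delta>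
  define P where "P \<delta> \<longleftrightarrow> 0 < (\<Sum>y\<in>Y. g y * \<delta> y) \<or> (\<Sum>y\<in>Y. g y * \<delta> y) = 0 \<and> P1 \<delta>" for \<delta>
  have P: "total_cone Y P"
    unfolding P_def P1_def by (intro total_cone_refine P0)
  interpret weighted_configuration Y a snd P
    by unfold_locales (use finY P in \<open>auto simp: a_def linear_iff\<close>)

  have p_Y: "p y \<in> dilated_simplex N" if "y \<in> Y" for y
    using that pts by (auto simp: Y_def p_def dilated_simplex_def axis_def if_distrib [of "\<lambda>c. _ * c"] cong: if_cong)
  have lincomb_pair: "lincomb Y a \<alpha> = ((\<Sum>y\<in>Y. \<alpha> y *\<^sub>R p y), sum \<alpha> Y)" for \<alpha>
    by (simp add: lincomb_def a_def sum_prod scaleR_prod_def)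
  have level_eq: "{z \<in> \<Lambda> \<inter> lincomb Y a ` weights. snd z = real t}
      = (\<lambda>q. (q, real t)) ` dilated_simplex (N * t)" for t
  proof
    show "{z \<in> \<Lambda> \<inter> lincomb Y a ` weights. snd z = real t}
        \<subseteq> (\<lambda>q. (q, real t)) ` dilated_simplex (N * t)"
    proof
      fix z assume z: "z \<in> {z \<in> \<Lambda> \<inter> lincomb Y a ` weights. snd z = real t}"
      then obtain \<alpha> where \<alpha>: "\<alpha> \<in> weights" "z = lincomb Y a \<alpha>"
        by blast
      define q where "q = fst z"
      have q: "q = (\<Sum>y\<in>Y. \<alpha> y *\<^sub>R p y)" and r: "sum \<alpha> Y = real t"
        using z by (simp_all add: \<alpha>(2) q_def lincomb_pair)
      have "0 \<le> q $ i" for i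
        unfolding q sum_component
      proof (rule sum_nonneg)
        fix y assume "y \<in> Y"
        then have "p y $ i \<in> \<nat>" "0 \<le> \<alpha> y"
          using p_Y \<alpha>(1) by (auto simp: dilated_simplex_def weights_def)
        then show "0 \<le> (\<alpha> y *\<^sub>R p y) $ i"
          by (auto simp: Nats_def)
      qed
      moreover have "q $ i \<in> \<int>" for i
        using z by (simp add: \<Lambda>_def q_def)
      ultimately have "q $ i \<in> \<nat>" for i
        by (simp add: Nats_altdef2)
      moreover have "(\<Sum>i\<in>UNIV. q $ i) = real (N * t)"
      proof -
        have "(\<Sum>i\<in>UNIV. q $ i) = (\<Sum>y\<in>Y. \<Sum>i\<in>UNIV. \<alpha> y * p y $ i)"
          unfolding q sum_component by (subst sum.swap) simp
        also have "\<dots> = (\<Sum>y\<in>Y. \<alpha> y * real N)"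
          using p_Y by (intro sum.cong) (simp_all add: sum_distrib_left [symmetric] dilated_simplex_def)
        also have "\<dots> = real (N * t)"
          by (simp add: sum_distrib_right [symmetric] r)
        finally show ?thesis .
      qed
      ultimately have "q \<in> dilated_simplex (N * t)"
        by (simp add: dilated_simplex_def)
      moreover have "z = (q, real t)"
        using z by (simp add: q_def prod_eq_iff)
      ultimately show "z \<in> (\<lambda>q. (q, real t)) ` dilated_simplex (N * t)"
        by blast
    qed
    show "(\<lambda>q. (q, real t)) ` dilated_simplex (N * t)
        \<subseteq> {z \<in> \<Lambda> \<inter> lincomb Y a ` weights. snd z = real t}"
    proof (rule image_subsetI)
      fix q :: "real ^ 'n" assume "q \<in> dilated_simplex (N * t)"
      then have q: "\<And>i. q $ i \<in> \<nat>" "(\<Sum>i\<in>UNIV. q $ i) = real (N * t)"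
        by (simp_all add: dilated_simplex_def)
      have nonneg: "0 \<le> q $ i" for i
        using q(1) [of i] by (auto simp: Nats_def)
      \<comment> \<open>Weights on the vertices that represent \<open>(q, t)\<close>. For \<open>N = 0\<close> all vertices coincide, and the
        whole weight \<open>t\<close> is put on an arbitrary one.\<close>
      define \<gamma> where "\<gamma> i = (if N = 0 then (if i = undefined then real t else 0) else q $ i / real N)"
        for i :: 'n
      define \<alpha> where "\<alpha> y = (case y of Inl x \<Rightarrow> 0 | Inr i \<Rightarrow> \<gamma> i)" for y :: "'x + 'n"
      have "\<alpha> \<in> weights"
      proof -
        have "Inr i \<in> Y" for i
          by (simp add: Y_def)
        then show ?thesis
          using nonneg by (auto simp: weights_def \<alpha>_def \<gamma>_def split: sum.split)
      qed
      moreover have "(\<Sum>y\<in>Y. \<alpha> y *\<^sub>R p y) = q"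
      proof -
        have "(\<Sum>y\<in>Y. \<alpha> y *\<^sub>R p y) = (\<Sum>y\<in>Inr ` UNIV. \<alpha> y *\<^sub>R p y)"
          by (rule sum.mono_neutral_right) (use finY in \<open>auto simp: Y_def \<alpha>_def\<close>)
        also have "\<dots> = (\<Sum>i\<in>UNIV. (\<gamma> i * real N) *\<^sub>R axis i 1)"
          by (subst sum.reindex) (auto simp: \<alpha>_def p_def)
        also have "\<dots> = (\<Sum>i\<in>UNIV. (q $ i) *\<^sub>R axis i 1)"
        proof (rule sum.cong [OF refl])
          fix i
          have "q $ i = 0" if "N = 0"
            using q(2) nonneg that by (simp add: sum_nonneg_eq_0_iff)
          then show "(\<gamma> i * real N) *\<^sub>R axis i 1 = (q $ i) *\<^sub>R (axis i 1 :: real ^ 'n)"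
            by (auto simp: \<gamma>_def)
        qed
        also have "\<dots> = q"
          by (simp add: vec_eq_iff sum_component axis_def if_distrib [of "\<lambda>c. _ * c"] cong: if_cong)
        finally show ?thesis .
      qed
      moreover have "sum \<alpha> Y = real t"
      proof -
        have "sum \<alpha> Y = sum \<alpha> (Inr ` UNIV)"
          by (rule sum.mono_neutral_right) (use finY in \<open>auto simp: Y_def \<alpha>_def\<close>)
        also have "\<dots> = (\<Sum>i\<in>UNIV. \<gamma> i)"
          by (subst sum.reindex) (auto simp: \<alpha>_def)
        also have "\<dots> = real t"
          using q(2) by (cases "N = 0") (simp_all add: \<gamma>_def sum_divide_distrib [symmetric])
        finally show ?thesis .
      qed
      ultimately have "(q, real t) \<in> lincomb Y a ` weights"
        by (intro image_eqI [of _ _ \<alpha>]) (simp_all add: lincomb_pair)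
      moreover have "(q, real t) \<in> \<Lambda>"
        using q(1) Nats_subset_Ints by (auto simp: \<Lambda>_def)
      ultimately show "(q, real t) \<in> {z \<in> \<Lambda> \<inter> lincomb Y a ` weights. snd z = real t}"
        by simp
    qed
  qed
  interpret lattice_configuration Y a snd P \<Lambda>
  proof
    show "finite {z \<in> \<Lambda> \<inter> lincomb Y a ` weights. snd z = real t}" for t
      unfolding level_eq by (simp add: card_dilated_simplex(1))
    show "a y \<in> \<Lambda>" if "y \<in> Y" for y
      using p_Y [OF that] Nats_subset_Ints by (auto simp: a_def \<Lambda>_def dilated_simplex_def)
  qed (auto simp: \<Lambda>_def)
  have card_level: "card (level t) = (N * t + CARD('n) - 1) choose (CARD('n) - 1)" for t
    unfolding level_def level_eq
    by (subst card_image) (auto simp: inj_on_def card_dilated_simplex(2))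

  define \<F> where "\<F> = {F \<in> range (lower_face X \<omega> pt). aff_dim (pt ` F) = int k}"
  have face: "supp \<alpha> \<subseteq> Inl ` lower_face X \<omega> pt w"
    if \<alpha>: "optimal \<alpha>" and \<mu>: "\<mu> \<in> weights" "supp \<mu> \<subseteq> Inl ` lower_face X \<omega> pt w"
      and eq: "lincomb Y a \<alpha> = lincomb Y a \<mu>" and "lower_face X \<omega> pt w \<noteq> {}" for \<alpha> \<mu> w
  proof (cases "\<mu> = \<alpha>")
    case True
    then show ?thesis using \<mu>(2) by simp
  next
    case False
    have "P (\<lambda>y. \<mu> y - \<alpha> y)"
      using \<alpha> \<mu>(1) eq False unfolding optimal_def by metis
    have \<alpha>w: "\<alpha> \<in> weights"
      using \<alpha> by (rule optimal_in_weights)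
    have \<alpha>_nonneg: "0 \<le> \<alpha> y" for y
      using \<alpha>w by (simp add: weights_def)
    have diff: "(\<Sum>y\<in>Y. h y * (\<mu> y - \<alpha> y)) = (\<Sum>y\<in>Y. h y * \<mu> y) - (\<Sum>y\<in>Y. h y * \<alpha> y)" for h :: "_ \<Rightarrow> real"
      by (simp add: right_diff_distrib sum_subtractf)
    have \<mu>_out: "\<mu> y = 0" if "y \<notin> Inl ` lower_face X \<omega> pt w" for y
      using weights_notin_supp [OF \<mu>(1)] \<mu>(2) that by blast
    have "(\<Sum>y\<in>Y. g y * \<mu> y) = 0"
      by (rule sum.neutral) (auto simp: g_def intro!: \<mu>_out split: sum.split)
    moreover have g_nonneg: "0 \<le> g y * \<alpha> y" for y
      using \<alpha>_nonneg by (simp add: g_def split: sum.split)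
    then have "0 \<le> (\<Sum>y\<in>Y. g y * \<alpha> y)"
      by (simp add: sum_nonneg)
    ultimately have g0: "(\<Sum>y\<in>Y. g y * \<alpha> y) = 0" and \<eta>le: "(\<Sum>y\<in>Y. \<eta> y * \<alpha> y) \<le> (\<Sum>y\<in>Y. \<eta> y * \<mu> y)"
      using \<open>P (\<lambda>y. \<mu> y - \<alpha> y)\<close> unfolding P_def P1_def diff by auto
    have \<alpha>_Inr: "\<alpha> (Inr i) = 0" for i
    proof -
      have "g (Inr i) * \<alpha> (Inr i) = 0"
        using g0 g_nonneg finY by (simp add: sum_nonneg_eq_0_iff Y_def)
      then show ?thesis by (simp add: g_def)
    qed
    obtain x0 where x0: "x0 \<in> lower_face X \<omega> pt w"
      using \<open>lower_face X \<omega> pt w \<noteq> {}\<close> by blast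
    define c where "c = \<omega> x0 + w \<bullet> pt x0"
    \<comment> \<open>The height above the supporting hyperplane: nonnegative on the configuration, zero exactly
      on the face. Its weighted sum depends on the combination and the lifting function only.\<close>
    define \<phi> where "\<phi> y = \<eta> y + w \<bullet> p y - c" for y
    have \<phi>_nonneg: "0 \<le> \<phi> (Inl x)" if "x \<in> X" for x
      using x0 that by (auto simp: \<phi>_def \<eta>_def p_def c_def lower_face_def)
    have \<phi>_zero: "\<phi> (Inl x) = 0 \<longleftrightarrow> x \<in> lower_face X \<omega> pt w" if "x \<in> X" for x
      using x0 that by (fastforce simp: \<phi>_def \<eta>_def p_def c_def lower_face_def)
    have expand: "(\<Sum>y\<in>Y. \<phi> y * \<nu> y) = (\<Sum>y\<in>Y. \<eta> y * \<nu> y) + w \<bullet> fst (lincomb Y a \<nu>) - c * snd (lincomb Y a \<nu>)" for \<nu>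
      by (simp add: lincomb_pair \<phi>_def algebra_simps sum.distrib sum_subtractf inner_sum_right sum_distrib_left)
    have "(\<Sum>y\<in>Y. \<phi> y * \<mu> y) = 0"
    proof (rule sum.neutral, intro ballI)
      fix y assume "y \<in> Y"
      show "\<phi> y * \<mu> y = 0"
      proof (cases "y \<in> Inl ` lower_face X \<omega> pt w")
        case True
        then obtain x where "y = Inl x" "x \<in> lower_face X \<omega> pt w" by blast
        then have "\<phi> y = 0"
          using \<phi>_zero [of x] by (auto simp: lower_face_def)
        then show ?thesis by simp
      qed (simp add: \<mu>_out)
    qed
    then have le0: "(\<Sum>y\<in>Y. \<phi> y * \<alpha> y) \<le> 0"
      using expand [of \<alpha>] expand [of \<mu>] eq \<eta>le by simp
    have nonneg: "0 \<le> \<phi> y * \<alpha> y" if "y \<in> Y" for y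
      using that \<phi>_nonneg \<alpha>_nonneg \<alpha>_Inr by (auto simp: Y_def)
    have zero: "\<phi> y * \<alpha> y = 0" if "y \<in> Y" for y
    proof -
      have "(\<Sum>y\<in>Y. \<phi> y * \<alpha> y) = 0"
        using le0 sum_nonneg [of Y "\<lambda>y. \<phi> y * \<alpha> y", OF nonneg] by linarith
      then show ?thesis
        using sum_nonneg_eq_0_iff [of Y "\<lambda>y. \<phi> y * \<alpha> y", OF finY nonneg] that by blast
    qed
    show ?thesis
    proof
      fix y assume "y \<in> supp \<alpha>"
      then have "y \<in> Y" "\<alpha> y \<noteq> 0"
        by (auto simp: supp_def)
      then have "\<phi> y = 0"
        using zero by auto
      obtain x where x: "y = Inl x" "x \<in> X"
        using \<open>y \<in> Y\<close> \<open>\<alpha> y \<noteq> 0\<close> \<alpha>_Inr by (auto simp: Y_def)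
      then show "y \<in> Inl ` lower_face X \<omega> pt w"
        using \<phi>_zero \<open>\<phi> y = 0\<close> by blast
    qed
  qed

  have simplex: "\<exists>\<sigma>\<in>simplices. \<sigma> \<subseteq> Inl ` F \<and> span (a ` \<sigma>) = span (a ` Inl ` F) \<and> card \<sigma> = Suc k"
    if F: "F \<in> \<F>" for F
  proof -
    obtain w where w: "F = lower_face X \<omega> pt w" and k: "aff_dim (pt ` F) = int k"
      using F by (auto simp: \<F>_def)
    have ne: "F \<noteq> {}"
      using k by auto
    have "\<exists>\<sigma>\<in>simplices. \<sigma> \<subseteq> Inl ` F \<and> span (a ` \<sigma>) = span (a ` Inl ` F)"
    proof (rule full_simplex_in_face)
      show "Inl ` F \<subseteq> Y"
        by (auto simp: w Y_def lower_face_def)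
      show "supp \<alpha> \<subseteq> Inl ` F"
        if "optimal \<alpha>" "\<mu> \<in> weights" "supp \<mu> \<subseteq> Inl ` F" "lincomb Y a \<alpha> = lincomb Y a \<mu>" for \<alpha> \<mu>
        using face [of \<alpha> \<mu> w] that ne by (simp add: w)
    qed (use ne in simp)
    then obtain \<sigma> where \<sigma>: "\<sigma> \<in> simplices" "\<sigma> \<subseteq> Inl ` F" "span (a ` \<sigma>) = span (a ` Inl ` F)"
      by blast
    have "a ` Inl ` F = (\<lambda>q. (q, 1)) ` pt ` F"
      by (simp add: image_image a_def p_def)
    then have "int (dim (a ` Inl ` F)) = int k + 1"
      using dim_homogenization [of "pt ` F"] k ne by simp
    then have "card \<sigma> = Suc k"
      using card_simplex [OF \<sigma>(1)] \<sigma>(3) by (metis dim_span nat_int of_nat_Suc add.commute)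
    then show ?thesis
      using \<sigma> by blast
  qed
  then obtain \<sigma> where \<sigma>: "\<And>F. F \<in> \<F> \<Longrightarrow> \<sigma> F \<in> simplices" "\<And>F. F \<in> \<F> \<Longrightarrow> \<sigma> F \<subseteq> Inl ` F"
    "\<And>F. F \<in> \<F> \<Longrightarrow> span (a ` \<sigma> F) = span (a ` Inl ` F)" "\<And>F. F \<in> \<F> \<Longrightarrow> card (\<sigma> F) = Suc k"
    by metis
  have sub: "F \<subseteq> G" if FG: "F \<in> \<F>" "G \<in> \<F>" "\<sigma> F = \<sigma> G" for F G
  proof
    fix x assume x: "x \<in> F"
    obtain w w' where w: "F = lower_face X \<omega> pt w" "G = lower_face X \<omega> pt w'"
      using FG(1,2) unfolding \<F>_def by blast
    have "\<sigma> F \<noteq> {}"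
      using \<sigma>(1) [OF FG(1)] by (simp add: simplices_def)
    then obtain x0 where "Inl x0 \<in> \<sigma> F"
      using \<sigma>(2) [OF FG(1)] by blast
    then have "x0 \<in> F" "x0 \<in> G"
      using \<sigma>(2) FG by blast+
    define c c' where "c = \<omega> x0 + w \<bullet> pt x0" and "c' = \<omega> x0 + w' \<bullet> pt x0"
    have onF: "\<omega> y + w \<bullet> pt y = c" if "y \<in> F" for y
      using that \<open>x0 \<in> F\<close> unfolding w(1) lower_face_def c_def by (auto intro: order_antisym)
    have onG: "\<omega> y + w' \<bullet> pt y = c'" if "y \<in> G" for y
      using that \<open>x0 \<in> G\<close> unfolding w(2) lower_face_def c'_def by (auto intro: order_antisym)
    \<comment> \<open>The difference of the two supporting functions is linear and vanishes on the common simplex,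
      hence on its span, which contains all points of \<open>F\<close>.\<close>
    have "span (a ` \<sigma> F) \<subseteq> {z. (w' - w) \<bullet> fst z - (c' - c) * snd z = 0}"
    proof (rule span_minimal)
      show "a ` \<sigma> F \<subseteq> {z. (w' - w) \<bullet> fst z - (c' - c) * snd z = 0}"
      proof (rule image_subsetI)
        fix y assume "y \<in> \<sigma> F"
        then obtain u where "y = Inl u" "u \<in> F" "u \<in> G"
          using \<sigma>(2) FG by blast
        then show "a y \<in> {z. (w' - w) \<bullet> fst z - (c' - c) * snd z = 0}"
          using onF [of u] onG [of u] by (simp add: a_def p_def inner_diff_left)
      qed
      show "subspace {z. (w' - w) \<bullet> fst z - (c' - c) * snd z = 0}"
        by (intro linear_subspace_kernel linearI) (simp_all add: algebra_simps)
    qed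
    moreover have "a (Inl x) \<in> span (a ` \<sigma> F)"
      unfolding \<sigma>(3) [OF FG(1)] using x by (intro span_base) blast
    ultimately have "(w' - w) \<bullet> pt x = c' - c"
      by (auto simp: a_def p_def)
    then have "\<omega> x + w' \<bullet> pt x = c'"
      using onF [OF x] by (simp add: inner_diff_left)
    moreover have "c' \<le> \<omega> y + w' \<bullet> pt y" if "y \<in> X" for y
      using \<open>x0 \<in> G\<close> that by (simp add: w(2) lower_face_def c'_def)
    moreover have "x \<in> X"
      using x by (simp add: w(1) lower_face_def)
    ultimately show "x \<in> G"
      by (simp add: w(2) lower_face_def)
  qed
  have "inj_on \<sigma> \<F>"
    using sub by (metis inj_onI subset_antisym)
  moreover have "\<sigma> ` \<F> \<subseteq> {\<tau> \<in> simplices. card \<tau> = Suc k}"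
    using \<sigma> by auto
  moreover have "finite {\<tau> \<in> simplices. card \<tau> = Suc k}"
    by (rule finite_subset [of _ "Pow Y"]) (use finY in \<open>auto simp: simplices_def\<close>)
  ultimately have "card \<F> \<le> card {\<tau> \<in> simplices. card \<tau> = Suc k}"
    by (rule card_inj_on_le)
  also have "int \<dots> \<le> (fdiff ^^ k) (\<lambda>m. int (card (level (Suc m)))) 0"
    by (rule card_simplices_le)
  finally show ?thesis
    by (simp only: \<F>_def card_level)
qed

section \<open>Cells dual to lower faces\<close>

definition exponent_vector :: "('n::finite \<Rightarrow>\<^sub>0 nat) \<Rightarrow> real ^ 'n" where
  "exponent_vector u = (\<chi> i. real (Poly_Mapping.lookup u i))"

definition coefficient_height :: "('k::field \<Rightarrow> ereal) \<Rightarrow> ('n::finite, 'k) mpoly \<Rightarrow> ('n \<Rightarrow>\<^sub>0 nat) \<Rightarrow> real" where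
  "coefficient_height v h u = real_of_ereal (v (Poly_Mapping.lookup h u))"

lemma minimizing_exponents_eq_lower_face:
  assumes "valuation v"
  shows "minimizing_exponents v h w =
    lower_face (Poly_Mapping.keys h) (coefficient_height v h) exponent_vector w"
proof -
  have val: "v (Poly_Mapping.lookup h u) = ereal (coefficient_height v h u)"
    if "u \<in> Poly_Mapping.keys h" for u
  proof -
    have "Poly_Mapping.lookup h u \<noteq> 0"
      using that by (simp add: in_keys_iff)
    then have "\<bar>v (Poly_Mapping.lookup h u)\<bar> \<noteq> \<infinity>"
      using assms by (auto simp: valuation_def)
    then show ?thesis
      by (simp add: coefficient_height_def ereal_real)
  qed
  have "(\<Sum>i\<in>UNIV. w $ i * real (Poly_Mapping.lookup u i)) = w \<bullet> exponent_vector u" for u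
    by (simp add: inner_vec_def exponent_vector_def)
  then show ?thesis
    using val by (auto simp: minimizing_exponents_def lower_face_def)
qed

lemma lower_face_subset: "lower_face X \<omega> pt w \<subseteq> X"
  by (auto simp: lower_face_def)

lemma lower_face_nonempty:
  assumes "finite X" and "X \<noteq> {}"
  shows "lower_face X \<omega> pt w \<noteq> {}"
proof -
  obtain x where "is_arg_min (\<lambda>x. \<omega> x + w \<bullet> pt x) (\<lambda>x. x \<in> X) x"
    using ex_is_arg_min_if_finite [OF assms] by blast
  then show ?thesis
    unfolding is_arg_min_linorder lower_face_def by blast
qed

text \<open>On a segment the lifted heights are convex combinations of those at the end points, and a
  common minimizer attains both minima.\<close>

lemma lower_face_segment:
  fixes w w' :: "real ^ 'n::finite"
  assumes "finite X" and "X \<noteq> {} \<Longrightarrow> lower_face X \<omega> pt w \<inter> lower_face X \<omega> pt w' \<noteq> {}"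
    and "0 < t" and "t < 1"
  shows "lower_face X \<omega> pt ((1 - t) *\<^sub>R w + t *\<^sub>R w') = lower_face X \<omega> pt w \<inter> lower_face X \<omega> pt w'"
proof (cases "X = {}")
  case True
  then show ?thesis by (simp add: lower_face_def)
next
  case False
  define f where "f x = \<omega> x + w \<bullet> pt x" for x
  define f' where "f' x = \<omega> x + w' \<bullet> pt x" for x
  obtain z where z: "z \<in> X" "\<And>x. x \<in> X \<Longrightarrow> f z \<le> f x" "\<And>x. x \<in> X \<Longrightarrow> f' z \<le> f' x"
    using assms(2) [OF False] by (auto simp: lower_face_def f_def f'_def)
  have conv: "\<omega> x + ((1 - t) *\<^sub>R w + t *\<^sub>R w') \<bullet> pt x = (1 - t) * f x + t * f' x" for x
    by (simp add: f_def f'_def inner_add_left algebra_simps)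
  have "(\<forall>y\<in>X. (1 - t) * f x + t * f' x \<le> (1 - t) * f y + t * f' y)
      \<longleftrightarrow> (\<forall>y\<in>X. f x \<le> f y) \<and> (\<forall>y\<in>X. f' x \<le> f' y)" (is "?L \<longleftrightarrow> ?R") if "x \<in> X" for x
  proof
    assume ?L
    then have le: "(1 - t) * f x + t * f' x \<le> (1 - t) * f z + t * f' z"
      using z(1) by blast
    have "(1 - t) * f z \<le> (1 - t) * f x" "t * f' z \<le> t * f' x"
      using z(2,3) [OF that] assms(3,4) by simp_all
    then have "(1 - t) * f x = (1 - t) * f z" "t * f' x = t * f' z"
      using le by linarith+
    then have "f x = f z" "f' x = f' z"
      using assms(3,4) by simp_all
    then show ?R
      using z(2,3) by simp
  next
    assume ?R
    then show ?L
      using assms(3,4) by (auto intro!: add_mono)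
  qed
  then show ?thesis
    unfolding lower_face_def conv by (auto simp: f_def f'_def)
qed

text \<open>From a point with a larger lower face, a step towards \<open>w\<close> reaches a point with the lower
  face of \<open>w\<close>, however short the step is.\<close>

lemma closure_same_lower_face:
  fixes w :: "real ^ 'n::finite"
  assumes "finite X"
  shows "closure {w'. lower_face X \<omega> pt w' = lower_face X \<omega> pt w} =
    {w'. lower_face X \<omega> pt w \<subseteq> lower_face X \<omega> pt w'}" (is "closure ?S = ?C")
proof
  have "closed ?C"
  proof -
    have "?C = (\<Inter>x\<in>lower_face X \<omega> pt w. \<Inter>y\<in>X. {w'. \<omega> x + w' \<bullet> pt x \<le> \<omega> y + w' \<bullet> pt y})"
      by (auto simp: lower_face_def)
    also have "closed \<dots>"
      by (intro closed_INT ballI closed_Collect_le continuous_intros)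
    finally show ?thesis .
  qed
  then show "closure ?S \<subseteq> ?C"
    by (intro closure_minimal) auto
  show "?C \<subseteq> closure ?S"
  proof
    fix w' assume w': "w' \<in> ?C"
    show "w' \<in> closure ?S"
    proof (cases "w' = w")
      case True
      then show ?thesis
        using closure_subset [of ?S] by auto
    next
      case False
      have "open_segment w' w \<subseteq> ?S"
      proof
        fix z assume "z \<in> open_segment w' w"
        then obtain t where t: "0 < t" "t < 1" "z = (1 - t) *\<^sub>R w' + t *\<^sub>R w"
          by (auto simp: in_segment)
        have "X \<noteq> {} \<Longrightarrow> lower_face X \<omega> pt w' \<inter> lower_face X \<omega> pt w \<noteq> {}"
          using lower_face_nonempty [OF assms, of \<omega> pt w] w' by auto
        then have "lower_face X \<omega> pt z = lower_face X \<omega> pt w' \<inter> lower_face X \<omega> pt w"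
          unfolding t(3) by (intro lower_face_segment assms t)
        then show "z \<in> ?S"
          using w' by auto
      qed
      then have "closure (open_segment w' w) \<subseteq> closure ?S"
        by (rule closure_mono)
      then show ?thesis
        using False by auto
    qed
  qed
qed

text \<open>A closed cell of the common refinement of the subdivisions given by the lifted
  configurations \<open>A h\<close>, written in terms of one of its relatively inner points \<open>w\<close>.\<close>

definition joint_cell ::
  "'h set \<Rightarrow> ('h \<Rightarrow> 'x set) \<Rightarrow> ('h \<Rightarrow> 'x \<Rightarrow> real) \<Rightarrow> ('x \<Rightarrow> real ^ 'n) \<Rightarrow> real ^ 'n \<Rightarrow> (real ^ 'n) set" where
  "joint_cell T A \<omega> pt w =
     {w'. \<forall>h\<in>T. lower_face (A h) (\<omega> h) pt w \<subseteq> lower_face (A h) (\<omega> h) pt w'}"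

text \<open>The cells that are intersected need not have a common inner point. A point of the
  intersection whose lower faces have the least total size is an inner point of the intersection:
  by \<open>lower_face_segment\<close> the midpoint to any other point has the intersections as lower faces.\<close>

lemma Inter_cells_eq_joint_cell:
  fixes pt :: "'x \<Rightarrow> real ^ 'n::finite"
  assumes "finite T" and finA: "\<And>h. h \<in> T \<Longrightarrow> finite (A h)"
    and C: "\<And>h. h \<in> T \<Longrightarrow> \<exists>w. C h = {w'. lower_face (A h) (\<omega> h) pt w \<subseteq> lower_face (A h) (\<omega> h) pt w'}"
    and "(\<Inter>h\<in>T. C h) \<noteq> {}"
  shows "\<exists>w. (\<Inter>h\<in>T. C h) = joint_cell T A \<omega> pt w"
proof -
  let ?M = "\<lambda>h. lower_face (A h) (\<omega> h) pt"
  obtain r where r: "\<And>h. h \<in> T \<Longrightarrow> C h = {w'. ?M h (r h) \<subseteq> ?M h w'}"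
    using C by metis
  let ?D = "\<Inter>h\<in>T. C h"
  obtain w1 where "w1 \<in> ?D"
    using assms(4) by blast
  from ex_has_least_nat [of "\<lambda>w. w \<in> ?D", OF this, of "\<lambda>w. \<Sum>h\<in>T. card (?M h w)"]
  obtain w where w: "w \<in> ?D" "\<And>w'. w' \<in> ?D \<Longrightarrow> (\<Sum>h\<in>T. card (?M h w)) \<le> (\<Sum>h\<in>T. card (?M h w'))"
    by blast
  have finM: "finite (?M h w')" if "h \<in> T" for h w'
    by (rule finite_subset [OF lower_face_subset finA [OF that]])
  have sub: "?M h w \<subseteq> ?M h w'" if w': "w' \<in> ?D" and h: "h \<in> T" for w' h
  proof -
    define z where "z = (1 - 1/2) *\<^sub>R w + (1/2) *\<^sub>R w'"
    have Mz: "?M g z = ?M g w \<inter> ?M g w'" if "g \<in> T" for g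
      unfolding z_def
    proof (rule lower_face_segment)
      show "?M g w \<inter> ?M g w' \<noteq> {}" if "A g \<noteq> {}"
      proof -
        have "?M g (r g) \<subseteq> ?M g w" "?M g (r g) \<subseteq> ?M g w'"
          using w(1) w' r \<open>g \<in> T\<close> by auto
        then show ?thesis
          using lower_face_nonempty [OF finA [OF \<open>g \<in> T\<close>] that, of "\<omega> g" pt "r g"] by blast
      qed
    qed (use finA that in auto)
    have "z \<in> ?D"
    proof
      fix g assume g: "g \<in> T"
      have "?M g (r g) \<subseteq> ?M g w" "?M g (r g) \<subseteq> ?M g w'"
        using w(1) w' r g by auto
      then show "z \<in> C g"
        using r [OF g] Mz [OF g] by auto
    qed
    have le: "card (?M g z) \<le> card (?M g w)" if "g \<in> T" for g
      unfolding Mz [OF that] using finM [OF that] by (intro card_mono) auto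
    have "(\<Sum>g\<in>T. card (?M g z)) = (\<Sum>g\<in>T. card (?M g w))"
      by (rule order_antisym [OF sum_mono [OF le] w(2) [OF \<open>z \<in> ?D\<close>]])
    then have "card (?M h z) = card (?M h w)"
      using le h assms(1) by (rule sum_mono_inv)
    then have "?M h z = ?M h w"
      using Mz [OF h] finM [OF h] by (intro card_subset_eq) auto
    then show ?thesis
      using Mz [OF h] by blast
  qed
  have "?D = joint_cell T A \<omega> pt w"
  proof
    show "?D \<subseteq> joint_cell T A \<omega> pt w"
      using sub unfolding joint_cell_def by blast
    show "joint_cell T A \<omega> pt w \<subseteq> ?D"
    proof
      fix w' assume w': "w' \<in> joint_cell T A \<omega> pt w"
      show "w' \<in> ?D"
      proof
        fix h assume h: "h \<in> T"
        have "?M h (r h) \<subseteq> ?M h w"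
          using w(1) r h by blast
        then show "w' \<in> C h"
          using w' h r [OF h] unfolding joint_cell_def by blast
      qed
    qed
  qed
  then show ?thesis ..
qed

text \<open>Near \<open>w\<close> the cell of \<open>w\<close> agrees with the affine space through \<open>w\<close> orthogonal to these
  differences.\<close>

definition face_directions ::
  "'h set \<Rightarrow> ('h \<Rightarrow> 'x set) \<Rightarrow> ('h \<Rightarrow> 'x \<Rightarrow> real) \<Rightarrow> ('x \<Rightarrow> real ^ 'n) \<Rightarrow> real ^ 'n \<Rightarrow> (real ^ 'n) set" where
  "face_directions T A \<omega> pt w =
     {pt u - pt u' | h u u'. h \<in> T \<and> u \<in> lower_face (A h) (\<omega> h) pt w \<and> u' \<in> lower_face (A h) (\<omega> h) pt w}"

text \<open>Moving orthogonally to the faces preserves the ties between minimizers, and for a short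
  while also the strict inequalities with all other points.\<close>

lemma joint_cell_contains_segment:
  fixes pt :: "'x \<Rightarrow> real ^ 'n::finite"
  assumes "finite T" and finA: "\<And>h. h \<in> T \<Longrightarrow> finite (A h)"
    and orth: "\<And>b. b \<in> face_directions T A \<omega> pt w \<Longrightarrow> orthogonal b y"
  shows "\<exists>e>0. w + e *\<^sub>R y \<in> joint_cell T A \<omega> pt w"
proof -
  let ?M = "\<lambda>h. lower_face (A h) (\<omega> h) pt"
  have "\<forall>\<^sub>F e in at_right 0. \<omega> h u + (w + e *\<^sub>R y) \<bullet> pt u \<le> \<omega> h x + (w + e *\<^sub>R y) \<bullet> pt x"
    if h: "h \<in> T" and u: "u \<in> ?M h w" and x: "x \<in> A h" for h u x
  proof (cases "x \<in> ?M h w")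
    case True
    then have "orthogonal (pt u - pt x) y"
      using orth h u by (auto simp: face_directions_def)
    then have "y \<bullet> pt u = y \<bullet> pt x"
      by (simp add: orthogonal_def inner_diff_left inner_commute [of y])
    moreover have "\<omega> h u + w \<bullet> pt u \<le> \<omega> h x + w \<bullet> pt x"
      using u x by (simp add: lower_face_def)
    ultimately show ?thesis
      by (simp add: inner_add_left)
  next
    case False
    then have "\<omega> h u + w \<bullet> pt u < \<omega> h x + w \<bullet> pt x"
      using u x unfolding lower_face_def by (smt (verit) mem_Collect_eq)
    then have pos: "0 < (\<omega> h x + w \<bullet> pt x) - (\<omega> h u + w \<bullet> pt u)"
      by simp
    have "((\<lambda>e. (\<omega> h x + (w + e *\<^sub>R y) \<bullet> pt x) - (\<omega> h u + (w + e *\<^sub>R y) \<bullet> pt u))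
        \<longlongrightarrow> (\<omega> h x + (w + 0 *\<^sub>R y) \<bullet> pt x) - (\<omega> h u + (w + 0 *\<^sub>R y) \<bullet> pt u)) (at_right 0)"
      by (intro tendsto_intros)
    then have "\<forall>\<^sub>F e in at_right 0. 0 < (\<omega> h x + (w + e *\<^sub>R y) \<bullet> pt x) - (\<omega> h u + (w + e *\<^sub>R y) \<bullet> pt u)"
      by (rule order_tendstoD(1)) (use pos in simp)
    then show ?thesis
      by (rule eventually_mono) simp
  qed
  then have "\<forall>\<^sub>F e in at_right 0. \<forall>h\<in>T. \<forall>u\<in>?M h w. \<forall>x\<in>A h.
      \<omega> h u + (w + e *\<^sub>R y) \<bullet> pt u \<le> \<omega> h x + (w + e *\<^sub>R y) \<bullet> pt x"
    by (intro eventually_ball_finite ballI)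
      (simp_all add: assms(1) finA finite_subset [OF lower_face_subset finA])
  moreover have "\<forall>\<^sub>F e :: real in at_right 0. 0 < e"
    by (simp add: eventually_at_right_less)
  ultimately have "\<forall>\<^sub>F e in at_right 0. 0 < e \<and> (\<forall>h\<in>T. \<forall>u\<in>?M h w. \<forall>x\<in>A h.
      \<omega> h u + (w + e *\<^sub>R y) \<bullet> pt u \<le> \<omega> h x + (w + e *\<^sub>R y) \<bullet> pt x)"
    by (simp add: eventually_conj_iff)
  then obtain e where e: "0 < e" "\<forall>h\<in>T. \<forall>u\<in>?M h w. \<forall>x\<in>A h.
      \<omega> h u + (w + e *\<^sub>R y) \<bullet> pt u \<le> \<omega> h x + (w + e *\<^sub>R y) \<bullet> pt x"
    using eventually_happens' [OF trivial_limit_at_right_real] by blast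
  then have "w + e *\<^sub>R y \<in> joint_cell T A \<omega> pt w"
    unfolding joint_cell_def by (auto simp: lower_face_def)
  then show ?thesis
    using e(1) by blast
qed

lemma torus_projection_eq:
  "torus_projection w = w - ((\<Sum>k\<in>UNIV. w $ k) / real CARD('n)) *\<^sub>R (1 :: real ^ 'n::finite)"
  by (simp add: torus_projection_def vec_eq_iff)

lemma linear_torus_projection: "linear torus_projection"
  by (rule linearI)
    (simp_all add: torus_projection_eq sum.distrib sum_distrib_left [symmetric] add_divide_distrib algebra_simps)

lemma one_inner: "(1 :: real ^ 'n::finite) \<bullet> w = (\<Sum>k\<in>UNIV. w $ k)"
  by (simp add: inner_vec_def)

text \<open>The affine hull of the projected cell is parallel to the orthogonal complement of
  the face directions and of the vector
  \<open>(1, \<dots>, 1)\<close>. The latter is orthogonal to the face directions, because the points of each \<open>A h\<close>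
  have the same coordinate sum; so it accounts for exactly one more dimension.\<close>

lemma aff_dim_projected_cell:
  fixes pt :: "'x \<Rightarrow> real ^ 'n::finite"
  assumes "finite T" and finA: "\<And>h. h \<in> T \<Longrightarrow> finite (A h)"
    and hom: "\<And>h u. h \<in> T \<Longrightarrow> u \<in> A h \<Longrightarrow> (\<Sum>i\<in>UNIV. pt u $ i) = deg h"
  shows "aff_dim (torus_projection ` joint_cell T A \<omega> pt w)
    = int CARD('n) - 1 - int (dim (face_directions T A \<omega> pt w))"
proof -
  let ?p = "torus_projection :: real ^ 'n \<Rightarrow> real ^ 'n" and ?cell = "joint_cell T A \<omega> pt w"
    and ?B = "face_directions T A \<omega> pt w"
  define Z where "Z = (\<lambda>x. x - ?p w) ` ?p ` ?cell"
  define V where "V = {y. \<forall>b\<in>insert 1 ?B. orthogonal b y}"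
  have one_B: "b \<bullet> 1 = 0" if "b \<in> ?B" for b
  proof -
    obtain h u u' where b: "b = pt u - pt u'" "h \<in> T" "u \<in> A h" "u' \<in> A h"
      using \<open>b \<in> ?B\<close> unfolding face_directions_def lower_face_def by blast
    then show ?thesis
      using hom [of h u] hom [of h u'] by (simp add: inner_commute [of _ 1] one_inner sum_subtractf)
  qed
  have "w \<in> ?cell"
    by (simp add: joint_cell_def)
  then have "?p w \<in> affine hull (?p ` ?cell)"
    by (intro hull_inc) blast
  then have "aff_dim (?p ` ?cell) = int (dim Z)"
    unfolding Z_def by (rule aff_dim_eq_dim_subtract)
  also have "dim Z = dim V"
  proof -
    have subV: "subspace V"
      by (auto simp: V_def subspace_def orthogonal_def inner_add_right)
    have "Z \<subseteq> V"
    proof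
      fix x assume "x \<in> Z"
      then obtain w' where w': "w' \<in> ?cell" "x = ?p w' - ?p w"
        by (auto simp: Z_def)
      have "x = ?p (w' - w)"
        by (simp add: w'(2) linear_diff [OF linear_torus_projection])
      then obtain c where x: "x = (w' - w) - c *\<^sub>R 1" and c: "c = (\<Sum>k\<in>UNIV. (w' - w) $ k) / real CARD('n)"
        by (simp add: torus_projection_eq)
      have "1 \<bullet> x = 0"
        by (simp add: x c one_inner sum_subtractf)
      moreover have "b \<bullet> x = 0" if "b \<in> ?B" for b
      proof -
        obtain h u u' where b: "b = pt u - pt u'" "h \<in> T"
          "u \<in> lower_face (A h) (\<omega> h) pt w" "u' \<in> lower_face (A h) (\<omega> h) pt w"
          using \<open>b \<in> ?B\<close> unfolding face_directions_def by blast
        then have "u \<in> lower_face (A h) (\<omega> h) pt w'" "u' \<in> lower_face (A h) (\<omega> h) pt w'"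
          using w'(1) by (auto simp: joint_cell_def)
        then have "\<omega> h u + w' \<bullet> pt u = \<omega> h u' + w' \<bullet> pt u'"
          by (auto simp: lower_face_def intro: order_antisym)
        moreover have "\<omega> h u + w \<bullet> pt u = \<omega> h u' + w \<bullet> pt u'"
          using b(3,4) by (auto simp: lower_face_def intro: order_antisym)
        ultimately have "(w' - w) \<bullet> b = 0"
          by (simp add: b(1) inner_diff_left inner_diff_right)
        then have "b \<bullet> (w' - w) = 0"
          by (simp add: inner_commute)
        then show ?thesis
          using one_B [OF that] by (simp add: x inner_diff_right)
      qed
      ultimately show "x \<in> V"
        by (simp add: V_def orthogonal_def)
    qed
    moreover have "V \<subseteq> span Z"
    proof
      fix y assume y: "y \<in> V"
      then obtain e where e: "0 < e" "w + e *\<^sub>R y \<in> ?cell"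
        using joint_cell_contains_segment [of T A \<omega> pt w y] assms(1) finA by (auto simp: V_def)
      have "1 \<bullet> y = 0"
        using y by (simp add: V_def orthogonal_def)
      then have "?p y = y"
        by (simp add: torus_projection_eq one_inner)
      then have "?p (w + e *\<^sub>R y) - ?p w = e *\<^sub>R y"
        by (simp add: linear_add [OF linear_torus_projection] linear_scale [OF linear_torus_projection])
      then have "e *\<^sub>R y \<in> Z"
        using e(2) unfolding Z_def by (metis image_eqI)
      then have "(1 / e) *\<^sub>R (e *\<^sub>R y) \<in> span Z"
        by (intro span_scale span_base)
      then show "y \<in> span Z"
        using e(1) by simp
    qed
    ultimately show ?thesis
      using subV by (metis dim_span span_minimal span_subspace subset_antisym)
  qed
  also have "int (dim V) = int CARD('n) - int (dim (insert 1 ?B))"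
  proof -
    have "V = {y \<in> UNIV. \<forall>x\<in>span (insert 1 ?B). orthogonal x y}"
    proof (intro equalityI subsetI)
      fix y assume "y \<in> V"
      then have "orthogonal y b" if "b \<in> insert 1 ?B" for b
      proof -
        have "orthogonal b y"
          using \<open>y \<in> V\<close> that unfolding V_def by blast
        then show ?thesis
          by (simp add: orthogonal_commute)
      qed
      then have "orthogonal y x" if "x \<in> span (insert 1 ?B)" for x
        using orthogonal_to_span [OF that] by blast
      then show "y \<in> {y \<in> UNIV. \<forall>x\<in>span (insert 1 ?B). orthogonal x y}"
        by (simp add: orthogonal_commute)
    qed (auto simp: V_def intro: span_base)
    then show ?thesis
      using dim_subspace_orthogonal_to_vectors [of "span (insert 1 ?B)" UNIV] by simp
  qed
  also have "dim (insert 1 ?B) = dim ?B + 1"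
  proof -
    have "1 \<notin> span ?B"
    proof
      assume "(1 :: real ^ 'n) \<in> span ?B"
      then have "orthogonal (1 :: real ^ 'n) 1"
        by (rule orthogonal_to_span) (use one_B in \<open>simp add: orthogonal_def inner_commute\<close>)
      then show False
        by (simp add: orthogonal_def)
    qed
    then show ?thesis
      by (simp add: dim_insert)
  qed
  finally show ?thesis
    by simp
qed

text \<open>A sum of independent terms is minimal if and only if each term is. The translation by \<open>s\<close>
  changes all heights by the same amount.\<close>

lemma lower_face_PiE:
  fixes pt :: "'x \<Rightarrow> real ^ 'n::finite"
  assumes "finite T" and fin: "\<And>h. h \<in> T \<Longrightarrow> finite (A h) \<and> A h \<noteq> {}"
  shows "lower_face (PiE T A) (\<lambda>f. \<Sum>h\<in>T. \<omega> h (f h)) (\<lambda>f. (\<Sum>h\<in>T. pt (f h)) + s) w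
    = PiE T (\<lambda>h. lower_face (A h) (\<omega> h) pt w)"
proof -
  define \<psi> where "\<psi> h u = \<omega> h u + w \<bullet> pt u" for h u
  have total: "(\<Sum>h\<in>T. \<omega> h (f h)) + w \<bullet> ((\<Sum>h\<in>T. pt (f h)) + s) = (\<Sum>h\<in>T. \<psi> h (f h)) + w \<bullet> s" for f
    by (simp add: \<psi>_def inner_add_right inner_sum_right sum.distrib)
  show ?thesis
  proof
    show "PiE T (\<lambda>h. lower_face (A h) (\<omega> h) pt w) \<subseteq>
        lower_face (PiE T A) (\<lambda>f. \<Sum>h\<in>T. \<omega> h (f h)) (\<lambda>f. (\<Sum>h\<in>T. pt (f h)) + s) w"
    proof
      fix f assume f: "f \<in> PiE T (\<lambda>h. lower_face (A h) (\<omega> h) pt w)"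
      then have "f \<in> PiE T A"
        by (auto simp: PiE_iff lower_face_def)
      moreover have "(\<Sum>h\<in>T. \<psi> h (f h)) \<le> (\<Sum>h\<in>T. \<psi> h (g h))" if "g \<in> PiE T A" for g
        using f that by (intro sum_mono) (auto simp: PiE_iff lower_face_def \<psi>_def)
      ultimately show "f \<in> lower_face (PiE T A) (\<lambda>f. \<Sum>h\<in>T. \<omega> h (f h)) (\<lambda>f. (\<Sum>h\<in>T. pt (f h)) + s) w"
        unfolding lower_face_def total by simp
    qed
    show "lower_face (PiE T A) (\<lambda>f. \<Sum>h\<in>T. \<omega> h (f h)) (\<lambda>f. (\<Sum>h\<in>T. pt (f h)) + s) w \<subseteq>
        PiE T (\<lambda>h. lower_face (A h) (\<omega> h) pt w)"
    proof
      fix f assume "f \<in> lower_face (PiE T A) (\<lambda>f. \<Sum>h\<in>T. \<omega> h (f h)) (\<lambda>f. (\<Sum>h\<in>T. pt (f h)) + s) w"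
      then have f: "f \<in> PiE T A" and min: "\<And>g. g \<in> PiE T A \<Longrightarrow> (\<Sum>h\<in>T. \<psi> h (f h)) \<le> (\<Sum>h\<in>T. \<psi> h (g h))"
        unfolding lower_face_def total by auto
      have "f h \<in> lower_face (A h) (\<omega> h) pt w" if h: "h \<in> T" for h
      proof -
        have "\<psi> h (f h) \<le> \<psi> h u" if u: "u \<in> A h" for u
        proof -
          have "f(h := u) \<in> PiE T A"
            using f u h by (auto simp: PiE_iff extensional_def)
          from min [OF this] have "(\<Sum>g\<in>T. \<psi> g (f g)) \<le> (\<Sum>g\<in>T. \<psi> g ((f(h := u)) g))" .
          moreover have "(\<Sum>g\<in>T - {h}. \<psi> g ((f(h := u)) g)) = (\<Sum>g\<in>T - {h}. \<psi> g (f g))"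
            by (rule sum.cong) auto
          ultimately show ?thesis
            using assms(1) h by (simp add: sum.remove)
        qed
        then show ?thesis
          using f h by (auto simp: lower_face_def \<psi>_def PiE_iff)
      qed
      then show "f \<in> PiE T (\<lambda>h. lower_face (A h) (\<omega> h) pt w)"
        using f by (auto simp: PiE_iff)
    qed
  qed
qed

text \<open>Changing a tuple in one entry shows that each difference within one \<open>M h\<close> is a difference
  of sums.\<close>

lemma aff_dim_sum_PiE:
  fixes pt :: "'x \<Rightarrow> real ^ 'n::finite"
  assumes "finite T" and ne: "\<And>h. h \<in> T \<Longrightarrow> M h \<noteq> {}"
  shows "aff_dim ((\<lambda>f. (\<Sum>h\<in>T. pt (f h)) + s) ` PiE T M)
    = int (dim {pt u - pt u' | h u u'. h \<in> T \<and> u \<in> M h \<and> u' \<in> M h})"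
proof -
  let ?q = "\<lambda>f. (\<Sum>h\<in>T. pt (f h)) + s"
  let ?B = "{pt u - pt u' | h u u'. h \<in> T \<and> u \<in> M h \<and> u' \<in> M h}"
  obtain f0 where f0: "f0 \<in> PiE T M"
    using ne by (metis PiE_eq_empty_iff ex_in_conv)
  define Z where "Z = (\<lambda>x. x - ?q f0) ` ?q ` PiE T M"
  have diff: "?q f - ?q g \<in> span Z" if "f \<in> PiE T M" "g \<in> PiE T M" for f g
  proof -
    have "?q f - ?q f0 \<in> Z" "?q g - ?q f0 \<in> Z"
      using that unfolding Z_def by blast+
    then have "?q f - ?q f0 \<in> span Z" "?q g - ?q f0 \<in> span Z"
      by (blast intro: span_base)+
    then have "(?q f - ?q f0) - (?q g - ?q f0) \<in> span Z"
      by (rule span_diff)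
    then show ?thesis
      by simp
  qed
  have "Z \<subseteq> span ?B"
  proof
    fix z assume "z \<in> Z"
    then obtain f where f: "f \<in> PiE T M" "z = ?q f - ?q f0"
      by (auto simp: Z_def)
    have "z = (\<Sum>h\<in>T. pt (f h) - pt (f0 h))"
      by (simp add: f(2) sum_subtractf)
    also have "\<dots> \<in> span ?B"
    proof (intro span_sum span_base)
      fix h assume "h \<in> T"
      then show "pt (f h) - pt (f0 h) \<in> ?B"
        using f(1) f0 PiE_mem by fast
    qed
    finally show "z \<in> span ?B" .
  qed
  moreover have "?B \<subseteq> span Z"
  proof
    fix b assume "b \<in> ?B"
    then obtain h u u' where b: "b = pt u - pt u'" "h \<in> T" "u \<in> M h" "u' \<in> M h"
      by blast
    have "f0(h := u) \<in> PiE T M" "f0(h := u') \<in> PiE T M"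
      using f0 b by (auto simp: PiE_iff extensional_def)
    then have mem: "?q (f0(h := u)) - ?q (f0(h := u')) \<in> span Z"
      by (rule diff)
    have rest: "(\<Sum>g\<in>T - {h}. pt ((f0(h := y)) g)) = (\<Sum>g\<in>T - {h}. pt (f0 g))" for y
      by (rule sum.cong) auto
    have "?q (f0(h := y)) = pt y + (\<Sum>g\<in>T - {h}. pt (f0 g)) + s" for y
      using assms(1) b(2) by (subst sum.remove [of T h]) (simp_all add: rest)
    then have "b = ?q (f0(h := u)) - ?q (f0(h := u'))"
      by (simp only: b(1)) simp
    then show "b \<in> span Z"
      using mem by simp
  qed
  ultimately have "span Z = span ?B"
    by (intro subset_antisym span_minimal subspace_span)
  from arg_cong [OF this, of dim] have "dim Z = dim ?B"
    by (simp only: dim_span)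
  moreover have "aff_dim (?q ` PiE T M) = int (dim Z)"
    unfolding Z_def using f0 by (intro aff_dim_eq_dim_subtract hull_inc) blast
  ultimately show ?thesis
    by simp
qed

section \<open>Tropical complexes\<close>

lemma exp_degree_homogeneous:
  assumes "homogeneous h" and "u \<in> Poly_Mapping.keys h"
  shows "exp_degree u = total_degree h"
proof -
  obtain e where e: "\<And>u. u \<in> Poly_Mapping.keys h \<Longrightarrow> exp_degree u = e"
    using assms(1) by (auto simp: homogeneous_def)
  then have "exp_degree ` Poly_Mapping.keys h = {e}"
    using assms(2) by force
  then show ?thesis
    using e [OF assms(2)] by (simp add: total_degree_def)
qed

lemma sum_exponent_vector: "(\<Sum>i\<in>UNIV. exponent_vector u $ i) = real (exp_degree u)"
  by (simp add: exponent_vector_def exp_degree_def)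

lemma common_refinement_cell:
  fixes T :: "('n::finite, 'k::field) mpoly set"
  assumes "valuation v" and "finite T" and "D \<in> common_refinement v T"
  shows "\<exists>w. D = joint_cell T Poly_Mapping.keys (coefficient_height v) exponent_vector w"
proof -
  obtain C where C: "D = (\<Inter>h\<in>T. C h)" "\<forall>h\<in>T. C h \<in> hypersurface_complex v h" "D \<noteq> {}"
    using assms(3) by (auto simp: common_refinement_def)
  show ?thesis
    unfolding C(1)
  proof (rule Inter_cells_eq_joint_cell)
    fix h assume "h \<in> T"
    then obtain w where "C h = closure {w'. minimizing_exponents v h w' = minimizing_exponents v h w}"
      using C(2) by (auto simp: hypersurface_complex_def)
    then show "\<exists>w. C h = {w'. lower_face (Poly_Mapping.keys h) (coefficient_height v h) exponent_vector w
        \<subseteq> lower_face (Poly_Mapping.keys h) (coefficient_height v h) exponent_vector w'}"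
      by (auto simp: minimizing_exponents_eq_lower_face [OF assms(1)] closure_same_lower_face)
  qed (use assms(2) C in auto)
qed

lemma projective_cell:
  fixes T :: "('n::finite, 'k::field) mpoly set"
  assumes "valuation v" and "finite T" and hom: "\<forall>h\<in>T. homogeneous h"
    and "\<C> \<subseteq> common_refinement v T" and "C \<in> projective_complex \<C>"
  obtains w where
    "C = torus_projection ` joint_cell T Poly_Mapping.keys (coefficient_height v) exponent_vector w"
    "aff_dim C = int CARD('n) - 1
      - int (dim (face_directions T Poly_Mapping.keys (coefficient_height v) exponent_vector w))"
proof -
  obtain D where D: "D \<in> \<C>" "C = torus_projection ` D"
    using assms(5) by (auto simp: projective_complex_def)
  obtain w where w: "D = joint_cell T Poly_Mapping.keys (coefficient_height v) exponent_vector w"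
    using common_refinement_cell [OF assms(1,2)] D(1) assms(4) by blast
  have "aff_dim C = int CARD('n) - 1
      - int (dim (face_directions T Poly_Mapping.keys (coefficient_height v) exponent_vector w))"
    unfolding D(2) w
    by (rule aff_dim_projected_cell [where deg = "\<lambda>h. real (total_degree h)"])
      (use assms(2) hom exp_degree_homogeneous in \<open>auto simp: sum_exponent_vector\<close>)
  then show thesis
    using that D(2) w by blast
qed

text \<open>Tuples of exponents, one for each nonzero polynomial, form the configuration. If its sums have
  degree \<open>e\<close>, a translation by \<open>N - e\<close> along a coordinate axis moves them into the dilated simplex of
  size \<open>N\<close>. A cell is recovered from its lower face \<open>F\<close> as the set of all points whose lower face
  contains \<open>F\<close>.\<close>

lemma f_vector_common_refinement_le:
  fixes T :: "('n::finite, 'k::field) mpoly set"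
  assumes v: "valuation v" and finT: "finite T"
    and hom: "\<forall>h\<in>T. homogeneous h" and deg: "\<forall>h\<in>T. total_degree h \<le> d"
    and "k + j + 1 = CARD('n)"
    and sub: "\<C> \<subseteq> common_refinement v T"
  shows "int (f_vector (projective_complex \<C>) j)
    \<le> (fdiff ^^ k) (\<lambda>m. int ((card T * d * Suc m + CARD('n) - 1) choose (CARD('n) - 1))) 0"
proof -
  let ?A = "Poly_Mapping.keys :: ('n, 'k) mpoly \<Rightarrow> _" and ?\<omega> = "coefficient_height v"
    and ?pt = "exponent_vector :: _ \<Rightarrow> real ^ 'n"
  define N where "N = card T * d"
  define T' where "T' = {h \<in> T. ?A h \<noteq> {}}"
  define e where "e = (\<Sum>h\<in>T'. total_degree h)"
  define shift :: "real ^ 'n" where "shift = real (N - e) *\<^sub>R axis undefined 1"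
  define X where "X = PiE T' ?A"
  define \<Omega> where "\<Omega> f = (\<Sum>h\<in>T'. ?\<omega> h (f h))" for f
  define q where "q f = (\<Sum>h\<in>T'. ?pt (f h)) + shift" for f
  define \<Phi> where "\<Phi> F = torus_projection ` {w'. F \<subseteq> lower_face X \<Omega> q w'}" for F
  have finT': "finite T'"
    using finT by (simp add: T'_def)
  have A: "finite (?A h) \<and> ?A h \<noteq> {}" if "h \<in> T'" for h
    using that by (simp add: T'_def)
  have finX: "finite X"
    unfolding X_def by (intro finite_PiE finT') simp
  have "e \<le> N"
  proof -
    have "e \<le> card T' * d"
      unfolding e_def using deg by (intro sum_bounded_above [where 'a = nat, simplified]) (auto simp: T'_def)
    also have "\<dots> \<le> N"
      unfolding N_def T'_def using finT by (intro mult_right_mono card_mono) auto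
    finally show ?thesis .
  qed
  have q_simplex: "q f \<in> dilated_simplex N" if f: "f \<in> X" for f
  proof -
    have "q f $ i \<in> \<nat>" for i
    proof -
      have "q f $ i = real ((\<Sum>h\<in>T'. Poly_Mapping.lookup (f h) i) + (if i = undefined then N - e else 0))"
        by (simp add: q_def shift_def sum_component exponent_vector_def axis_def)
      then show ?thesis
        by (metis of_nat_in_Nats)
    qed
    moreover have "(\<Sum>i\<in>UNIV. q f $ i) = real N"
    proof -
      have "(\<Sum>i\<in>UNIV. q f $ i) = (\<Sum>i\<in>UNIV. \<Sum>h\<in>T'. ?pt (f h) $ i) + (\<Sum>i\<in>UNIV. shift $ i)"
        by (simp add: q_def sum.distrib sum_component)
      also have "(\<Sum>i\<in>UNIV. \<Sum>h\<in>T'. ?pt (f h) $ i) = (\<Sum>h\<in>T'. real (exp_degree (f h)))"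
        by (subst sum.swap) (simp add: sum_exponent_vector)
      also have "\<dots> = real e"
        unfolding e_def of_nat_sum
      proof (rule sum.cong [OF refl])
        fix h assume "h \<in> T'"
        then show "real (exp_degree (f h)) = real (total_degree h)"
          using f hom exp_degree_homogeneous by (auto simp: X_def T'_def PiE_iff)
      qed
      also have "(\<Sum>i\<in>UNIV. shift $ i) = real (N - e)"
        by (simp add: shift_def axis_def if_distrib [of "\<lambda>c. _ * c"] cong: if_cong)
      finally show ?thesis
        using \<open>e \<le> N\<close> by simp
    qed
    ultimately show ?thesis
      by (simp add: dilated_simplex_def)
  qed
  have face: "lower_face X \<Omega> q w = PiE T' (\<lambda>h. lower_face (?A h) (?\<omega> h) ?pt w)" for w
    unfolding X_def \<Omega>_def [abs_def] q_def [abs_def] by (rule lower_face_PiE [OF finT' A])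
  have face_ne: "lower_face (?A h) (?\<omega> h) ?pt w \<noteq> {}" if "h \<in> T'" for h w
    using A [OF that] by (intro lower_face_nonempty) auto
  have cell: "joint_cell T ?A ?\<omega> ?pt w = {w'. lower_face X \<Omega> q w \<subseteq> lower_face X \<Omega> q w'}" for w
  proof -
    have sub_iff: "lower_face X \<Omega> q w \<subseteq> lower_face X \<Omega> q w' \<longleftrightarrow>
        (\<forall>h\<in>T'. lower_face (?A h) (?\<omega> h) ?pt w \<subseteq> lower_face (?A h) (?\<omega> h) ?pt w')" for w'
      unfolding face subset_PiE using face_ne by (simp add: PiE_eq_empty_iff)
    have out: "lower_face (?A h) (?\<omega> h) ?pt w = {}" if "h \<in> T - T'" for h w
    proof -
      have "?A h = {}"
        using that unfolding T'_def by blast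
      then show ?thesis
        by (simp add: lower_face_def)
    qed
    have "T' \<subseteq> T"
      by (auto simp: T'_def)
    then have "(\<forall>h\<in>T. lower_face (?A h) (?\<omega> h) ?pt w \<subseteq> lower_face (?A h) (?\<omega> h) ?pt w') \<longleftrightarrow>
        (\<forall>h\<in>T'. lower_face (?A h) (?\<omega> h) ?pt w \<subseteq> lower_face (?A h) (?\<omega> h) ?pt w')" for w'
      using out by blast
    then show ?thesis
      by (simp only: joint_cell_def sub_iff)
  qed
  have dim_face: "aff_dim (q ` lower_face X \<Omega> q w) = int (dim (face_directions T ?A ?\<omega> ?pt w))" for w
  proof -
    have "{?pt u - ?pt u' | h u u'. h \<in> T' \<and> u \<in> lower_face (?A h) (?\<omega> h) ?pt w \<and>
        u' \<in> lower_face (?A h) (?\<omega> h) ?pt w} = face_directions T ?A ?\<omega> ?pt w"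
      unfolding face_directions_def T'_def using lower_face_subset by fast
    moreover have "aff_dim (q ` PiE T' (\<lambda>h. lower_face (?A h) (?\<omega> h) ?pt w))
        = int (dim {?pt u - ?pt u' | h u u'. h \<in> T' \<and> u \<in> lower_face (?A h) (?\<omega> h) ?pt w \<and>
        u' \<in> lower_face (?A h) (?\<omega> h) ?pt w})"
      unfolding q_def [abs_def] by (rule aff_dim_sum_PiE [OF finT' face_ne])
    ultimately show ?thesis
      by (simp only: face)
  qed
  have "{C \<in> projective_complex \<C>. aff_dim C = int j}
      \<subseteq> \<Phi> ` {F \<in> range (lower_face X \<Omega> q). aff_dim (q ` F) = int k}"
  proof
    fix C assume "C \<in> {C \<in> projective_complex \<C>. aff_dim C = int j}"
    then have C: "C \<in> projective_complex \<C>" and dimC: "aff_dim C = int j"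
      by auto
    obtain w where w: "C = torus_projection ` joint_cell T ?A ?\<omega> ?pt w"
      "aff_dim C = int CARD('n) - 1 - int (dim (face_directions T ?A ?\<omega> ?pt w))"
      by (rule projective_cell [OF v finT hom sub C])
    then have "aff_dim (q ` lower_face X \<Omega> q w) = int k"
      using w(2) dimC assms(5) dim_face [of w] by linarith
    moreover have "C = \<Phi> (lower_face X \<Omega> q w)"
      by (simp add: \<Phi>_def w(1) cell)
    ultimately show "C \<in> \<Phi> ` {F \<in> range (lower_face X \<Omega> q). aff_dim (q ` F) = int k}"
      by blast
  qed
  moreover have fin: "finite {F \<in> range (lower_face X \<Omega> q). aff_dim (q ` F) = int k}"
    by (rule finite_subset [of _ "Pow X"]) (use finX in \<open>auto simp: lower_face_def\<close>)
  ultimately have "f_vector (projective_complex \<C>) j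
      \<le> card {F \<in> range (lower_face X \<Omega> q). aff_dim (q ` F) = int k}"
    unfolding f_vector_def by (meson card_image_le card_mono finite_imageI le_trans)
  then have "int (f_vector (projective_complex \<C>) j)
      \<le> int (card {F \<in> range (lower_face X \<Omega> q). aff_dim (q ` F) = int k})"
    by simp
  also have "\<dots> \<le> (fdiff ^^ k) (\<lambda>m. int ((N * Suc m + CARD('n) - 1) choose (CARD('n) - 1))) 0"
    by (rule card_lower_faces_le [OF finX q_simplex])
  finally show ?thesis
    by (simp only: N_def)
qed

lemma f_vector_large_dimension:
  fixes T :: "('n::finite, 'k::field) mpoly set"
  assumes v: "valuation v" and finT: "finite T" and hom: "\<forall>h\<in>T. homogeneous h"
    and sub: "\<C> \<subseteq> common_refinement v T" and j: "CARD('n) \<le> j"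
  shows "f_vector (projective_complex \<C>) j = 0"
proof -
  have "aff_dim C \<noteq> int j" if "C \<in> projective_complex \<C>" for C
    by (rule projective_cell [OF v finT hom sub that]) (use j in linarith)
  then have "{C \<in> projective_complex \<C>. aff_dim C = int j} = {}"
    by blast
  then show ?thesis
    by (simp only: f_vector_def card.empty)
qed

theorem proposition10:
  fixes v :: "'k::field \<Rightarrow> ereal"
    and vL :: "'l::alg_closed_field \<Rightarrow> ereal"
    and \<iota> :: "'k \<Rightarrow> 'l"
    and I T :: "('n::finite, 'k) mpoly set"
    and s d j :: nat
  assumes "valuation v"
    and "nontrivial_valuation vL"
    and "valued_field_extension v vL \<iota>"
    and "homogeneous_ideal I"
    and "tropical_basis vL \<iota> I T"
    and "\<forall>h\<in>T. homogeneous h"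
    and "card T = s"
    and "\<forall>h\<in>T. total_degree h \<le> d"
  shows "int (f_vector (projective_complex (tropical_complex v vL \<iota> I T)) j)
    \<le> (\<Sum>i = 1..CARD('n) - j. (- 1) ^ (CARD('n) + i - j)
          * int ((CARD('n) - j - 1) choose (i - 1))
          * int ((s * d * i + CARD('n) - 1) choose (CARD('n) - 1)))"
proof -
  have finT: "finite T"
    using assms(5) by (simp add: tropical_basis_def)
  have sub: "tropical_complex v vL \<iota> I T \<subseteq> common_refinement v T"
    by (auto simp: tropical_complex_def)
  show ?thesis
  proof (cases "j < CARD('n)")
    case False
    then show ?thesis
      using f_vector_large_dimension [OF assms(1) finT assms(6) sub, of j] by simp
  next
    case True
    define k where "k = CARD('n) - j - 1"
    define L where "L m = int ((s * d * Suc m + CARD('n) - 1) choose (CARD('n) - 1))" for m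
    have kj: "k + j + 1 = CARD('n)"
      using True by (simp add: k_def)
    have "int (f_vector (projective_complex (tropical_complex v vL \<iota> I T)) j) \<le> (fdiff ^^ k) L 0"
      using f_vector_common_refinement_le [OF assms(1) finT assms(6,8) kj sub]
      by (simp only: L_def [abs_def] assms(7))
    also have "\<dots> = (\<Sum>m\<le>k. (-1) ^ (k + m) * int (k choose m) * L m)"
      by (simp add: funpow_fdiff_alternating)
    also have "\<dots> = (\<Sum>i = Suc 0..Suc k. (- 1) ^ (k + i + 1) * int (k choose (i - 1)) * L (i - 1))"
      unfolding sum.shift_bounds_cl_Suc_ivl by (simp add: atMost_atLeast0)
    also have "\<dots> = (\<Sum>i = 1..CARD('n) - j. (- 1) ^ (CARD('n) + i - j)
          * int ((CARD('n) - j - 1) choose (i - 1))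
          * int ((s * d * i + CARD('n) - 1) choose (CARD('n) - 1)))"
    proof (rule sum.cong)
      show "{Suc 0..Suc k} = {1..CARD('n) - j}"
        using kj by auto
      fix i assume "i \<in> {1..CARD('n) - j}"
      then have "k + i + 1 = CARD('n) + i - j" "Suc (i - 1) = i"
        using kj by auto
      then show "(- 1) ^ (k + i + 1) * int (k choose (i - 1)) * L (i - 1)
          = (- 1) ^ (CARD('n) + i - j) * int ((CARD('n) - j - 1) choose (i - 1))
            * int ((s * d * i + CARD('n) - 1) choose (CARD('n) - 1))"
        by (simp only: L_def k_def)
    qed
    finally show ?thesis .
  qed
qed

end
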